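(* Let $p$ be a prime and let $\zeta_A(x,y)$ be the characteristic $p$ zeta function of $A=\mathbb{F}_p[T]$ (the case $r=p$). Let $y\in\mathbb{Z}_p$ be arbitrary, let $\alpha$ be a zero in $x$ of $\zeta_A(x,y)$, and set $j:=\nu_\infty(\alpha)$ (which is a positive integer divisible by $p-1$). Let $n=n(j,y)$ be the number of zeroes $\beta$ in $x$ of $\zeta_A(x,y)$ with $\nu_\infty(\beta)\le j$. Then: (a) $n(j,y)=l(j)/(p-1)$. (b) $-j\sim_n y$, where $n=n(j,y)$. (c) The zero of $\zeta_A(x,-j)$ corresponding to $\alpha$ (that is, the unique zero in $x$ of $\zeta_A(x,-j)$ of valuation $j$) is precisely the trivial zero $x=\pi^j$ of $\zeta_A(x,-j)$.
   Context: Let $K=\mathbb{F}_p((1/T))$ with normalized additive valuation $\nu_\infty$, $\nu_\infty(1/T)=1$, and let $\mathbf{C}_\infty$ be the completion of an algebraic closure of $K$, with the extended valuation. Fix a positive uniformizer $\pi\in K$ (i.e. $\nu_\infty(\pi)=1$ and the leading coefficient of $\pi$ as a series in $1/T$ is $1$). For a monic $n\in\mathbb{F}_p[T]$ put $\langle n\rangle:=\pi^{\deg n}n$, a $1$-unit of $K$, so $\langle n\rangle^{y}$ makes sense for $y\in\mathbb{Z}_p$. For $x\in\mathbf{C}_\infty^*$ and $y\in\mathbb{Z}_p$, $$\zeta_A(x,y)=\sum_{i=0}^\infty a_i(y)x^{-i},\qquad a_i(y)=\sum_{n\text{ monic},\ \deg n=i}\langle n\rangle^{-y};$$ for each fixed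 $y$ this is an entire power series in $x^{-1}$. A "zero in $x$" of $\zeta_A(x,y)$ is an element $\alpha\in\mathbf{C}_\infty^*$ with $\zeta_A(\alpha,y)=0$. It is known that all zeroes are simple, lie in $K$, and that for fixed $y$ distinct zeroes have distinct valuations. For a positive integer $j$ divisible by $p-1$, $x=\pi^j$ is a simple zero of $\zeta_A(x,-j)$, called the trivial zero at $-j$. For a non-negative integer $j=\sum_t c_tp^t$ with $0\le c_t<p$, $l(j)=\sum_t c_t$. The Newton polygon of $\zeta_A(x,y)$ (in $x^{-1}$) is the lower convex hull of the points $(i,\nu_\infty(a_i(y)))$ in $\mathbb{R}^2$, those with $a_i(y)=0$ being omitted. For a positive integer $n$, the equivalence relation $\sim_n$ on $\mathbb{Z}_p$ is defined as follows: if the Newton polygons of $\zeta_A(x,y_1)$ and $\zeta_A(x,y_2)$ both have at least $n$ finite slopes, then $y_1\sim_n y_2$ if and only if these two Newton polygons have the same first $n$ segments; if the Newton polygon of $\zeta_A(x,y)$ does not have $n$ finite slopes, then $y$ is equivalent only to itself. *)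

theory Defs
  imports
    "HOL-Analysis.Analysis"
    "HOL-Computational_Algebra.Computational_Algebra"
    "HOL-Algebra.Algebraic_Closure_Type"
begin

text \<open>
  The residue field \<open>\<bbbF>\<^sub>p\<close> is a field type \<open>'k\<close> of prime cardinality \<open>p\<close>, and
  \<open>K = \<bbbF>\<^sub>p((1/T))\<close> is \<^typ>\<open>'k fls\<close> with series variable \<open>fls_X = 1/T\<close>. Hence \<open>T\<close> is
  \<open>fls_X_inv\<close>, and \<open>\<nu>\<^sub>\<infinity>\<close> on nonzero elements of \<open>K\<close> is \<^const>\<open>fls_subdegree\<close>.
\<close>

definition poly_in_K :: "'k::field poly \<Rightarrow> 'k fls" where
  "poly_in_K n = poly (map_poly fls_const n) fls_X_inv"

definition positive_uniformizer :: "'k::field fls \<Rightarrow> bool" where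
  "positive_uniformizer \<pi> \<longleftrightarrow> \<pi> \<noteq> 0 \<and> fls_subdegree \<pi> = 1 \<and> fls_nth \<pi> (fls_subdegree \<pi>) = 1"


text \<open>
  Up to isometric isomorphism over \<open>K\<close>, the field \<open>\<^bold>C\<^sub>\<infinity>\<close> is given by a complete field type
  \<open>'c\<close> with a dense embedding of the algebraic closure of \<open>K\<close> and a valuation \<open>\<nu>\<close> that extends
  \<open>\<nu>\<^sub>\<infinity>\<close> and induces the metric. (Since \<open>K\<close> is complete, its valuation has only one extension to the
  algebraic closure, so \<open>\<nu>\<close> is determined.) Completeness is part of the class
  \<^class>\<open>complete_space\<close>. The value \<open>\<nu> 0\<close> is unconstrained and stands for infinity.
\<close>

definition is_C_infinity ::
  "('k::{finite,field} fls alg_closure \<Rightarrow> 'c::{field,complete_space}) \<Rightarrow> ('c \<Rightarrow> real) \<Rightarrow> bool" where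
  "is_C_infinity emb \<nu> \<longleftrightarrow>
     emb 1 = 1 \<and>
     (\<forall>x y. emb (x + y) = emb x + emb y) \<and>
     (\<forall>x y. emb (x * y) = emb x * emb y) \<and>
     (\<forall>x y. x \<noteq> 0 \<longrightarrow> y \<noteq> 0 \<longrightarrow> \<nu> (x * y) = \<nu> x + \<nu> y) \<and>
     (\<forall>x y. x \<noteq> 0 \<longrightarrow> y \<noteq> 0 \<longrightarrow> x + y \<noteq> 0 \<longrightarrow> \<nu> (x + y) \<ge> min (\<nu> x) (\<nu> y)) \<and>
     (\<forall>f. f \<noteq> 0 \<longrightarrow> \<nu> (emb (to_ac f)) = real_of_int (fls_subdegree f)) \<and>
     (\<forall>x y. x \<noteq> y \<longrightarrow> dist x y = real CARD('k) powr (- \<nu> (x - y))) \<and>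
     closure (range emb) = UNIV"


text \<open>
  \<open>\<int>\<^sub>p\<close> as the inverse limit of the rings \<open>\<int>/p\<^sup>n\<close>: the \<open>n\<close>-th entry of a sequence is the
  residue modulo \<open>p\<^sup>n\<close>.
\<close>

definition padic_ints :: "nat \<Rightarrow> (nat \<Rightarrow> int) set" where
  "padic_ints p = {y. \<forall>n. y n \<in> {0..<int p ^ n} \<and> y (Suc n) mod int p ^ n = y n}"

definition padic_of_int :: "nat \<Rightarrow> int \<Rightarrow> nat \<Rightarrow> int" where
  "padic_of_int p m = (\<lambda>n. m mod int p ^ n)"

definition padic_uminus :: "nat \<Rightarrow> (nat \<Rightarrow> int) \<Rightarrow> nat \<Rightarrow> int" where
  "padic_uminus p y = (\<lambda>n. (- y n) mod int p ^ n)"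

text \<open>
  For a 1-unit \<open>u\<close>, the power \<open>u\<^sup>y\<close> is the limit in \<open>K\<close> of \<open>u\<^sup>m\<close> for natural numbers \<open>m\<close> tending
  to \<open>y\<close> in \<open>\<int>\<^sub>p\<close>.
\<close>

definition one_unit_power :: "'k::field fls \<Rightarrow> (nat \<Rightarrow> int) \<Rightarrow> 'k fls" where
  "one_unit_power u y = lim (\<lambda>n. u ^ nat (y n))"

definition one_unit_part :: "'k::field fls \<Rightarrow> 'k poly \<Rightarrow> 'k fls" where
  "one_unit_part \<pi> n = \<pi> ^ Polynomial.degree n * poly_in_K n"

definition zeta_coeff :: "'k::{finite,field} fls \<Rightarrow> (nat \<Rightarrow> int) \<Rightarrow> nat \<Rightarrow> 'k fls" where
  "zeta_coeff \<pi> y i =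
     (\<Sum>n | Polynomial.lead_coeff n = 1 \<and> Polynomial.degree n = i.
        one_unit_power (one_unit_part \<pi> n) (padic_uminus CARD('k) y))"

definition zeta_A ::
  "('k::{finite,field} fls alg_closure \<Rightarrow> 'c::{field,complete_space}) \<Rightarrow> 'k fls \<Rightarrow>
   'c \<Rightarrow> (nat \<Rightarrow> int) \<Rightarrow> 'c" where
  "zeta_A emb \<pi> x y = (\<Sum>i. emb (to_ac (zeta_coeff \<pi> y i)) * inverse x ^ i)"

definition zeta_zeros ::
  "('k::{finite,field} fls alg_closure \<Rightarrow> 'c::{field,complete_space}) \<Rightarrow> 'k fls \<Rightarrow>
   (nat \<Rightarrow> int) \<Rightarrow> 'c set" where
  "zeta_zeros emb \<pi> y = {\<alpha>. \<alpha> \<noteq> 0 \<and> zeta_A emb \<pi> \<alpha> y = 0}"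


text \<open>For \<open>p \<ge> 2\<close> all digits in positions beyond \<open>j\<close> vanish.\<close>

definition digit_sum :: "nat \<Rightarrow> nat \<Rightarrow> nat" where
  "digit_sum p j = (\<Sum>t\<le>j. (j div p ^ t) mod p)"


definition newton_points :: "(nat \<Rightarrow> 'k::zero fls) \<Rightarrow> (real \<times> real) set" where
  "newton_points a = {(real i, real_of_int (fls_subdegree (a i))) | i. a i \<noteq> 0}"

definition lower_convex_hull :: "(real \<times> real) set \<Rightarrow> (real \<times> real) set" where
  "lower_convex_hull S =
     {q \<in> convex hull S. \<forall>t. (fst q, t) \<in> convex hull S \<longrightarrow> snd q \<le> t}"

definition newton_vertices :: "(real \<times> real) set \<Rightarrow> (real \<times> real) set" where
  "newton_vertices S = {q \<in> lower_convex_hull S. q extreme_point_of (convex hull S)}"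

text \<open>
  A segment of the polygon joins two consecutive vertices; the polygon being convex, distinct
  segments have distinct slopes, so counting finite slopes is counting segments. The position
  of a segment (starting with 1) is the number of vertices strictly to the left of its right
  endpoint.
\<close>

definition newton_segment_at :: "(real \<times> real) set \<Rightarrow> nat \<Rightarrow> (real \<times> real) set \<Rightarrow> bool" where
  "newton_segment_at S k L \<longleftrightarrow>
     (\<exists>q\<in>newton_vertices S. \<exists>r\<in>newton_vertices S.
        fst q < fst r \<and>
        \<not> (\<exists>s\<in>newton_vertices S. fst q < fst s \<and> fst s < fst r) \<and>
        finite {s \<in> newton_vertices S. fst s < fst r} \<and>
        k = card {s \<in> newton_vertices S. fst s < fst r} \<and>
        L = closed_segment q r)"

definition has_finite_slopes :: "(real \<times> real) set \<Rightarrow> nat \<Rightarrow> bool" where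
  "has_finite_slopes S n \<longleftrightarrow> (\<forall>k\<in>{1..n}. \<exists>L. newton_segment_at S k L)"

definition same_first_segments :: "(real \<times> real) set \<Rightarrow> (real \<times> real) set \<Rightarrow> nat \<Rightarrow> bool" where
  "same_first_segments S S' n \<longleftrightarrow>
     (\<forall>k\<in>{1..n}. \<forall>L. newton_segment_at S k L \<longleftrightarrow> newton_segment_at S' k L)"

definition newton_equiv ::
  "'k::{finite,field} fls \<Rightarrow> nat \<Rightarrow> (nat \<Rightarrow> int) \<Rightarrow> (nat \<Rightarrow> int) \<Rightarrow> bool" where
  "newton_equiv \<pi> n y1 y2 \<longleftrightarrow>
     (let S1 = newton_points (zeta_coeff \<pi> y1); S2 = newton_points (zeta_coeff \<pi> y2)
      in if has_finite_slopes S1 n \<and> has_finite_slopes S2 n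
         then same_first_segments S1 S2 n
         else y1 = y2)"

end

theory Submission
  imports Defs "HOL-Number_Theory.Cong"
begin

text \<open>
  Put \<open>m = - y\<close> and split \<open>m\<close> into powers of \<open>p\<close>, each repeated as often as its digit says.
  Summing over the constant coefficient of the monic polynomials gives a recursion in the degree:
  only exponents \<open>k > 0\<close> divisible by \<open>p - 1\<close> with \<open>m choose k\<close> prime to \<open>p\<close> survive, i.e. sums of
  a positive multiple of \<open>p - 1\<close> of these powers. The term of least valuation is unique, namely
  the sum of the smallest \<open>p - 1\<close> powers. Hence the valuations of consecutive coefficients differ
  by \<open>s\<^sub>i\<close>, the sum of the \<open>i (p - 1)\<close> smallest powers in \<open>m\<close>, and the coefficients vanish once
  \<open>m\<close> has fewer powers. The \<open>s\<^sub>i\<close> increase strictly, so they are the slopes of the Newton polygon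
  and there is exactly one zero of each valuation \<open>s\<^sub>i\<close>. If \<open>j = s\<^sub>i\<close>, then \<open>j\<close> has digit sum
  \<open>i (p - 1)\<close> and shares its \<open>i (p - 1)\<close> smallest powers with \<open>m\<close>. The trivial zero comes from
  the same recursion, applied to the sum of \<open>n ^ j\<close> over all polynomials \<open>n\<close> of bounded degree.
\<close>

section \<open>Digits in base \<open>p\<close>\<close>

text \<open>That the residue field has exactly \<open>p\<close> elements makes the greedy choice
  legal: \<open>p\<close> is 1 modulo \<open>p - 1\<close>, so whether \<open>p - 1\<close> divides
  a sum of powers of \<open>p\<close> depends only on how many powers it has, and the
  \<open>p - 1\<close> smallest powers always form an admissible exponent. Its term wins by a
  slope-by-slope comparison. Up to a constant, the term for \<open>k\<close> in the step to degree
  \<open>i + 1\<close> has as valuation the first \<open>i\<close> slopes belonging to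
  \<open>m - k\<close>, plus \<open>k\<close> once for each of the \<open>i + 1\<close> new slopes.
  Each slope so shifted is a subsum of \<open>m\<close> with at least as many powers as the slope it
  is compared with, hence at least as large. The remaining constant is a multiple of
  \<open>m\<close>, and \<open>\<pi> ^ (i * m)\<close> cancels it. This allows the p-adic
  \<open>m\<close> to be replaced by its residues modulo \<open>p ^ N\<close>, which determine the
  coefficients up to precision \<open>p ^ N\<close>; all work with digits then takes place in the
  natural numbers. Slopes are integers, so on a sphere of zeros every other term is smaller than the
  two dominant ones by a factor \<open>p\<close> at least. This factor is the contraction constant
  that yields existence and uniqueness of the zero.\<close>

lemma digit_sum_rec:
  assumes "1 < p"
  shows "digit_sum p m = m mod p + digit_sum p (m div p)"
proof -
  \<comment> \<open>The bound of the defining sum depends on the argument, so \<open>m\<close> and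
    \<open>m div p\<close> are first brought to freely chosen larger bounds.\<close>
  have ext: "digit_sum p m = (\<Sum>t\<le>N. (m div p ^ t) mod p)" if "m \<le> N" for m N
  proof -
    have "(m div p ^ t) mod p = 0" if "m < t" for t
    proof -
      have "t < p ^ t" using power_gt_expt[of p t] assms by simp
      with that show ?thesis by simp
    qed
    then show ?thesis unfolding digit_sum_def
      by (intro sum.mono_neutral_left) (use that in auto)
  qed
  have "digit_sum p m = (\<Sum>t\<le>Suc m. (m div p ^ t) mod p)"
    by (rule ext) simp
  also have "\<dots> = m mod p + (\<Sum>t\<le>m. (m div p ^ Suc t) mod p)"
    by (subst sum.atMost_Suc_shift) simp
  also have "(\<Sum>t\<le>m. (m div p ^ Suc t) mod p) = (\<Sum>t\<le>m. (m div p div p ^ t) mod p)"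
    by (simp add: div_mult2_eq)
  also have "\<dots> = digit_sum p (m div p)"
    by (rule ext[symmetric]) simp
  finally show ?thesis .
qed

lemma digit_sum_0 [simp]: "digit_sum p 0 = 0"
  by (simp add: digit_sum_def)

lemma digit_sum_le:
  assumes "1 < p"
  shows "digit_sum p m \<le> m"
proof (induction m rule: less_induct)
  case (less m)
  show ?case
  proof (cases "m = 0")
    case False
    then have "digit_sum p (m div p) \<le> m div p" using less assms by simp
    also have "\<dots> \<le> p * (m div p)" using assms by simp
    finally show ?thesis
      using digit_sum_rec[OF assms, of m] mult_div_mod_eq[of p m] by linarith
  qed simp
qed

lemma digit_sum_eq_self:
  assumes "m < p"
  shows "digit_sum p m = m"
proof (cases "m = 0")
  case False
  then have "1 < p" using assms by simp
  from digit_sum_rec[OF this, of m] assms show ?thesis by simp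
qed simp

lemma digit_sum_mult_add:
  assumes "1 < p" "b < p"
  shows "digit_sum p (p * a + b) = b + digit_sum p a"
  using digit_sum_rec[OF assms(1), of "p * a + b"] assms by simp

lemma digit_sum_eq_0_iff:
  assumes "1 < p"
  shows "digit_sum p m = 0 \<longleftrightarrow> m = 0"
proof (induction m rule: less_induct)
  case (less m)
  show ?case
  proof (cases "m = 0")
    case False
    then have IH: "digit_sum p (m div p) = 0 \<longleftrightarrow> m div p = 0" using less assms by simp
    show ?thesis
      using digit_sum_rec[OF assms, of m] IH False by (auto simp: div_eq_0_iff)
  qed simp
qed

text \<open>Casting out: \<open>p\<close> is 1 modulo \<open>p - 1\<close>, so every power of
  \<open>p\<close> counts as 1.\<close>

lemma cong_digit_sum:
  assumes "1 < p"
  shows "[m = digit_sum p m] (mod (p - 1))"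
proof (induction m rule: less_induct)
  case (less m)
  show ?case
  proof (cases "m = 0")
    case False
    then have IH: "[m div p = digit_sum p (m div p)] (mod (p - 1))" using less assms by simp
    have "[p = 1] (mod (p - 1))"
      using assms by (simp add: cong_def mod_if le_mod_geq)
    then have "[p * (m div p) + m mod p = 1 * digit_sum p (m div p) + m mod p] (mod (p - 1))"
      by (intro cong_add cong_mult IH) auto
    then show ?thesis
      using digit_sum_rec[OF assms, of m] by (simp add: add.commute)
  qed simp
qed

lemma dvd_pred_iff_digit_sum:
  assumes "1 < p"
  shows "(p - 1) dvd m \<longleftrightarrow> (p - 1) dvd digit_sum p m"
  using cong_digit_sum[OF assms] by (rule cong_dvd_iff)

text \<open>Induction on \<open>a\<close>, splitting off the block of \<open>p\<close> with Vandermonde's convolution.\<close>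

lemma lucas_cong_nat:
  assumes p: "normalization_semidom_class.prime p" and "b < p" "d < p"
  shows "[(p * a + b) choose (p * c + d) = (a choose c) * (b choose d)] (mod p)"
proof (induction a arbitrary: c)
  case 0
  show ?case
  proof (cases c)
    case (Suc c')
    then have "b < p * c + d" using \<open>b < p\<close> by simp
    then show ?thesis using Suc by (simp add: binomial_eq_0)
  qed simp
next
  case (Suc a)
  have p0: "0 < p" using p by (rule prime_gt_0_nat)
  let ?n = "p * c + d" and ?M = "p * a + b"
  define g where "g k = (p choose k) * (?M choose (?n - k))" for k
  have "(p * Suc a + b) choose ?n = (\<Sum>k\<le>?n. g k)"
    unfolding g_def using vandermonde[of p ?M ?n] by (simp add: algebra_simps)
  also have "[\<dots> = (\<Sum>k\<le>?n. if k \<in> {0, p} then g k else 0)] (mod p)"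
  proof (rule cong_sum)
    fix k
    have "p dvd g k" if "k \<noteq> 0" "k \<noteq> p"
    proof (cases "k < p")
      case True
      then show ?thesis unfolding g_def using that p p0
        by (intro dvd_mult2 dvd_choose_prime) auto
    next
      case False
      then show ?thesis using that by (simp add: g_def binomial_eq_0)
    qed
    then show "[g k = (if k \<in> {0, p} then g k else 0)] (mod p)"
      by (auto simp: cong_0_iff)
  qed
  also have "(\<Sum>k\<le>?n. if k \<in> {0, p} then g k else 0) = (\<Sum>k\<in>{..?n} \<inter> {0, p}. g k)"
    by (rule sum.inter_restrict[symmetric]) simp
  also have "[\<dots> = (Suc a choose c) * (b choose d)] (mod p)"
  proof (cases c)
    case 0
    then have "{..?n} \<inter> {0, p} = {0}" using \<open>d < p\<close> by auto
    then have "(\<Sum>k\<in>{..?n} \<inter> {0, p}. g k) = ?M choose ?n" by (simp only: g_def) simp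
    then show ?thesis using Suc.IH[of 0] 0 by simp
  next
    case (Suc c')
    then have "{..?n} \<inter> {0, p} = {0, p}" by auto
    moreover have "?n - p = p * c' + d" using Suc by simp
    ultimately have "(\<Sum>k\<in>{..?n} \<inter> {0, p}. g k) = (?M choose (p * c + d)) + (?M choose (p * c' + d))"
      using p0 by (simp add: g_def)
    also have "[\<dots> = (a choose c) * (b choose d) + (a choose c') * (b choose d)] (mod p)"
      by (intro cong_add Suc.IH)
    also have "(a choose c) * (b choose d) + (a choose c') * (b choose d)
        = (Suc a choose c) * (b choose d)"
      using Suc by (simp add: algebra_simps)
    finally show ?thesis .
  qed
  finally show ?case .
qed

text \<open>For \<open>d \<le> b\<close> the binomial coefficient divides \<open>fact b\<close>,
  which is prime to \<open>p\<close> because \<open>b < p\<close>.\<close>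

lemma prime_dvd_choose_iff:
  assumes p: "normalization_semidom_class.prime (p::nat)" and "b < p"
  shows "p dvd (b choose d) \<longleftrightarrow> b < d"
proof
  assume "p dvd (b choose d)"
  moreover have "\<not> p dvd fact b" using p \<open>b < p\<close> by (simp add: prime_dvd_fact_iff)
  moreover have "(b choose d) dvd fact b" if "d \<le> b"
    using binomial_fact_lemma[OF that] by (metis dvd_triv_right)
  ultimately show "b < d" by (meson dvd_trans not_le)
qed (simp add: binomial_eq_0)

lemma not_dvd_choose_rec:
  assumes p: "normalization_semidom_class.prime p"
  shows "\<not> p dvd (m choose k) \<longleftrightarrow> \<not> p dvd (m div p choose (k div p)) \<and> k mod p \<le> m mod p"
proof -
  have p0: "0 < p" using p by (rule prime_gt_0_nat)
  have "[m choose k = (m div p choose (k div p)) * (m mod p choose (k mod p))] (mod p)"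
    using lucas_cong_nat[OF p, of "m mod p" "k mod p" "m div p" "k div p"] p0 by simp
  then have "p dvd (m choose k) \<longleftrightarrow> p dvd (m div p choose (k div p)) * (m mod p choose (k mod p))"
    by (rule cong_dvd_iff)
  also have "\<dots> \<longleftrightarrow> p dvd (m div p choose (k div p)) \<or> m mod p < k mod p"
    using p p0 by (simp add: prime_dvd_mult_iff prime_dvd_choose_iff)
  finally show ?thesis by auto
qed

text \<open>By Lucas's theorem this is the digitwise order in base \<open>p\<close>:
  \<open>k\<close> is a subsum of the powers that make up \<open>m\<close>. The binomial form is the
  one met in the recursion; \<open>submask_rec\<close> gives the digits one at a time.\<close>

definition submask :: "nat \<Rightarrow> nat \<Rightarrow> nat \<Rightarrow> bool" where
  "submask p k m \<longleftrightarrow> \<not> p dvd (m choose k)"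

lemma submask_rec:
  "normalization_semidom_class.prime p \<Longrightarrow>
    submask p k m \<longleftrightarrow> submask p (k div p) (m div p) \<and> k mod p \<le> m mod p"
  unfolding submask_def by (rule not_dvd_choose_rec)

lemma submask_le: "submask p k m \<Longrightarrow> k \<le> m"
  unfolding submask_def by (rule ccontr) (simp add: binomial_eq_0)

lemma submask_0 [simp]: "normalization_semidom_class.prime p \<Longrightarrow> submask p 0 m"
  by (auto simp: submask_def)

text \<open>Subtracting a submask never borrows.\<close>

lemma submask_diff_div_mod:
  assumes p: "normalization_semidom_class.prime p" and "submask p k m"
  shows "(m - k) div p = m div p - k div p" "(m - k) mod p = m mod p - k mod p"
proof -
  have p0: "0 < p" using p by (rule prime_gt_0_nat)
  have le: "k div p \<le> m div p" "k mod p \<le> m mod p"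
    using assms submask_rec[OF p, of k m] submask_le by auto
  obtain a b where m: "m = p * a + b" "b < p"
    by (rule that[of "m div p" "m mod p"]) (use p0 in auto)
  obtain c d where k: "k = p * c + d" "d < p"
    by (rule that[of "k div p" "k mod p"]) (use p0 in auto)
  have "c \<le> a" "d \<le> b" using le m k p0 by auto
  then have *: "m - k = p * (a - c) + (b - d)"
    using m k by (simp add: diff_mult_distrib2)
  have "b - d < p" using m by simp
  then show "(m - k) div p = m div p - k div p" "(m - k) mod p = m mod p - k mod p"
    unfolding * using m k p0 by simp_all
qed

lemma digit_sum_submask:
  assumes p: "normalization_semidom_class.prime p" and "submask p k m"
  shows "digit_sum p m = digit_sum p k + digit_sum p (m - k)"
  using assms(2)
proof (induction m arbitrary: k rule: less_induct)
  case (less m)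
  have p1: "1 < p" using p by (rule prime_gt_1_nat)
  show ?case
  proof (cases "m = 0")
    case True
    then show ?thesis using submask_le[OF less.prems] by simp
  next
    case False
    have s: "submask p (k div p) (m div p)" "k mod p \<le> m mod p"
      using less.prems submask_rec[OF p, of k m] by auto
    have "digit_sum p (m div p) = digit_sum p (k div p) + digit_sum p (m div p - k div p)"
      by (rule less.IH) (use s False p1 in auto)
    then show ?thesis
      using s digit_sum_rec[OF p1, of m] digit_sum_rec[OF p1, of k] digit_sum_rec[OF p1, of "m - k"]
        submask_diff_div_mod[OF p less.prems] by simp
  qed
qed

text \<open>\<open>k\<close> and \<open>k'\<close> use disjoint collections of the powers in
  \<open>m\<close>, so adding them produces no carry.\<close>

lemma submask_add:
  assumes p: "normalization_semidom_class.prime p" and "submask p k m" "submask p k' (m - k)"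
  shows "submask p (k + k') m"
    and "digit_sum p (k + k') = digit_sum p k + digit_sum p k'"
proof -
  have p1: "1 < p" using p by (rule prime_gt_1_nat)
  have "submask p (k + k') m \<and> digit_sum p (k + k') = digit_sum p k + digit_sum p k'"
    using assms(2,3)
  proof (induction m arbitrary: k k' rule: less_induct)
    case (less m)
    show ?case
    proof (cases "m = 0")
      case True
      then show ?thesis using submask_le[OF less.prems(1)] submask_le[OF less.prems(2)] p by simp
    next
      case False
      have s: "submask p (k div p) (m div p)" "k mod p \<le> m mod p"
        using less.prems submask_rec[OF p, of k m] by auto
      have s': "submask p (k' div p) (m div p - k div p)" "k' mod p \<le> m mod p - k mod p"
        using less.prems submask_rec[OF p, of k' "m - k"] submask_diff_div_mod[OF p less.prems(1)]
        by auto
      have IH: "submask p (k div p + k' div p) (m div p)"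
        "digit_sum p (k div p + k' div p) = digit_sum p (k div p) + digit_sum p (k' div p)"
        using less.IH[of "m div p" "k div p" "k' div p"] s s' False p1 by auto
      have lt: "k mod p + k' mod p < p"
        using s(2) s'(2) p1 mod_less_divisor[of p m] by linarith
      have "k + k' = p * (k div p + k' div p) + (k mod p + k' mod p)"
        by (simp add: algebra_simps)
      then have dm: "(k + k') div p = k div p + k' div p" "(k + k') mod p = k mod p + k' mod p"
        using lt by (metis div_mult_self4 div_less add.right_neutral gr_implies_not0,
            metis mod_mult_self4 mod_less)
      show ?thesis
        using IH dm s s' submask_rec[OF p, of "k + k'" m] digit_sum_rec[OF p1, of "k + k'"]
          digit_sum_rec[OF p1, of k] digit_sum_rec[OF p1, of k'] by auto
    qed
  qed
  then show "submask p (k + k') m" "digit_sum p (k + k') = digit_sum p k + digit_sum p k'" by auto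
qed

text \<open>
  Write \<open>m\<close> as a sum of powers of \<open>p\<close>, each repeated as often as its digit says:
  \<open>low_digits p r m\<close> is the sum of the \<open>r\<close> smallest summands (and \<open>m\<close> if there are fewer).
\<close>

function low_digits :: "nat \<Rightarrow> nat \<Rightarrow> nat \<Rightarrow> nat" where
  "low_digits p r m =
    (if m = 0 \<or> p \<le> 1 then 0
     else if r \<le> m mod p then r
     else m mod p + p * low_digits p (r - m mod p) (m div p))"
  by auto
termination by (relation "Wellfounded.measure (\<lambda>(p, r, m). m)") auto

declare low_digits.simps [simp del]

lemma low_digits_0 [simp]: "low_digits p r 0 = 0"
  by (simp add: low_digits.simps)

lemma low_digits_0_left [simp]: "low_digits p 0 m = 0"
  by (simp add: low_digits.simps)

lemma low_digits_small: "1 < p \<Longrightarrow> r \<le> m mod p \<Longrightarrow> low_digits p r m = r"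
  by (cases "m = 0") (simp_all add: low_digits.simps[of p r m])

lemma low_digits_large: "1 < p \<Longrightarrow> m mod p \<le> r \<Longrightarrow>
    low_digits p r m = m mod p + p * low_digits p (r - m mod p) (m div p)"
  by (cases "m = 0") (simp_all add: low_digits.simps[of p r m])

lemma submask_low_digits:
  assumes p: "normalization_semidom_class.prime p" and "r \<le> digit_sum p m"
  shows "submask p (low_digits p r m) m" and "digit_sum p (low_digits p r m) = r"
proof -
  have p1: "1 < p" using p by (rule prime_gt_1_nat)
  have "submask p (low_digits p r m) m \<and> digit_sum p (low_digits p r m) = r"
    using assms(2)
  proof (induction m arbitrary: r rule: less_induct)
    case (less m)
    consider "m = 0" | "r \<le> m mod p" | "m > 0" "m mod p < r" by linarith
    then show ?case
    proof cases
      case 1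
      then show ?thesis using less p by simp
    next
      case 2
      then have "r < p" using p1 mod_less_divisor[of p m] by linarith
      then show ?thesis using 2 low_digits_small[OF p1 2] submask_rec[OF p, of r m] p
        by (simp add: digit_sum_eq_self)
    next
      case 3
      let ?c = "low_digits p (r - m mod p) (m div p)"
      have "submask p ?c (m div p) \<and> digit_sum p ?c = r - m mod p"
        using less.IH[of "m div p" "r - m mod p"] less.prems 3 p1 digit_sum_rec[OF p1, of m] by auto
      moreover have "low_digits p r m = p * ?c + m mod p" using low_digits_large[OF p1, of m r] 3 by simp
      ultimately show ?thesis
        using submask_rec[OF p, of "p * ?c + m mod p" m] digit_sum_mult_add[OF p1, of "m mod p" ?c] p1 3
        by simp
    qed
  qed
  then show "submask p (low_digits p r m) m" "digit_sum p (low_digits p r m) = r" by auto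
qed

lemma low_digits_strict_mono:
  assumes p: "normalization_semidom_class.prime p" and "r < r'" "r' \<le> digit_sum p m"
  shows "low_digits p r m < low_digits p r' m"
  using assms(2,3)
proof (induction m arbitrary: r r' rule: less_induct)
  case (less m)
  have p1: "1 < p" using p by (rule prime_gt_1_nat)
  have "m \<noteq> 0" using less.prems by (intro notI) simp
  consider "r' \<le> m mod p" | "r \<le> m mod p" "m mod p < r'" | "m mod p < r" by linarith
  then show ?case
  proof cases
    case 1
    then show ?thesis using less.prems low_digits_small[OF p1] by simp
  next
    case 2
    have "low_digits p 0 (m div p) < low_digits p (r' - m mod p) (m div p)"
      using less.IH[of "m div p" 0 "r' - m mod p"] less.prems \<open>m \<noteq> 0\<close> p1 2
        digit_sum_rec[OF p1, of m] by auto
    then have "0 < p * low_digits p (r' - m mod p) (m div p)" using p1 by simp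
    then show ?thesis
      using 2 low_digits_small[OF p1, of r m] low_digits_large[OF p1, of m r'] by linarith
  next
    case 3
    have "low_digits p (r - m mod p) (m div p) < low_digits p (r' - m mod p) (m div p)"
      using less.IH[of "m div p" "r - m mod p" "r' - m mod p"] less.prems \<open>m \<noteq> 0\<close> p1 3
        digit_sum_rec[OF p1, of m] by auto
    then show ?thesis
      using 3 low_digits_large[OF p1, of m r] low_digits_large[OF p1, of m r'] less.prems p1 by simp
  qed
qed

text \<open>Extremality of the greedy choice: any subsum of \<open>m\<close> with at least
  \<open>r\<close> powers is at least as large as the \<open>r\<close> smallest ones.\<close>

lemma low_digits_le:
  assumes p: "normalization_semidom_class.prime p" and "submask p k m" "r \<le> digit_sum p k"
  shows "low_digits p r m \<le> k"
  using assms(2,3)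
proof (induction m arbitrary: r k rule: less_induct)
  case (less m)
  have p1: "1 < p" using p by (rule prime_gt_1_nat)
  consider "m = 0" | "r \<le> m mod p" | "m > 0" "m mod p < r" by linarith
  then show ?case
  proof cases
    case 2
    then show ?thesis using low_digits_small[OF p1 2] less.prems digit_sum_le[OF p1, of k] by simp
  next
    case 3
    have s: "submask p (k div p) (m div p)" "k mod p \<le> m mod p"
      using less.prems submask_rec[OF p, of k m] by auto
    have lk: "digit_sum p k = k mod p + digit_sum p (k div p)"
      by (rule digit_sum_rec[OF p1])
    have IH: "low_digits p (r - k mod p) (m div p) \<le> k div p"
      using less.IH[of "m div p" "k div p" "r - k mod p"] s 3 p1 less.prems lk by auto
    have low: "low_digits p r m = m mod p + p * low_digits p (r - m mod p) (m div p)"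
      using low_digits_large[OF p1, of m r] 3 by simp
    have k: "k = k mod p + p * (k div p)" by simp
    show ?thesis
    proof (cases "k mod p = m mod p")
      case True
      then have "p * low_digits p (r - m mod p) (m div p) \<le> p * (k div p)"
        using IH by (intro mult_le_mono2) simp
      then show ?thesis using low k True by linarith
    next
      case False
      \<comment> \<open>A \<open>k\<close> that omits some of the lowest powers must take more of
        the higher ones. Its quotient by \<open>p\<close> is then larger by at least 1, and the gain
        of \<open>p\<close> outweighs the last digit of \<open>m\<close>.\<close>
      then have "low_digits p (r - m mod p) (m div p) < low_digits p (r - k mod p) (m div p)"
        using s 3 less.prems lk digit_sum_submask[OF p s(1)]
        by (intro low_digits_strict_mono[OF p]) auto
      then have "Suc (low_digits p (r - m mod p) (m div p)) \<le> k div p" using IH by simp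
      then have "p * Suc (low_digits p (r - m mod p) (m div p)) \<le> p * (k div p)" by (rule mult_le_mono2)
      then have "p + p * low_digits p (r - m mod p) (m div p) \<le> p * (k div p)" by simp
      moreover have "m mod p < p" using p1 by simp
      ultimately show ?thesis using low k by linarith
    qed
  qed simp
qed

text \<open>Needed for the equality case of the slope comparison: once the smallest powers are
  removed, the smallest remaining ones continue the same list.\<close>

lemma low_digits_add:
  assumes p: "normalization_semidom_class.prime p" and "r + s \<le> digit_sum p m"
  shows "low_digits p r m + low_digits p s (m - low_digits p r m) = low_digits p (r + s) m"
  using assms(2)
proof (induction m arbitrary: r s rule: less_induct)
  case (less m)
  have p1: "1 < p" using p by (rule prime_gt_1_nat)
  let ?k = "low_digits p r m"
  have "r \<le> digit_sum p m" using less.prems by simp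
  note sub = submask_low_digits(1)[OF p this]
  note dm = submask_diff_div_mod[OF p sub]
  consider "m = 0" | "r + s \<le> m mod p" | "r \<le> m mod p" "m mod p < r + s" "m > 0"
    | "m > 0" "m mod p < r" by linarith
  then show ?case
  proof cases
    case 2
    then have "r < p" using p1 mod_less_divisor[of p m] by linarith
    have k: "?k = r" using low_digits_small[OF p1] 2 by simp
    then have "(m - r) mod p = m mod p - r" using dm \<open>r < p\<close> by simp
    then show ?thesis using k 2 low_digits_small[OF p1, of s "m - r"] low_digits_small[OF p1, of "r + s" m]
      by simp
  next
    case 3
    then have "r < p" using p1 mod_less_divisor[of p m] by linarith
    have k: "?k = r" using low_digits_small[OF p1] 3 by simp
    then have "(m - r) mod p = m mod p - r" "(m - r) div p = m div p" using dm \<open>r < p\<close> by simp_all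
    then show ?thesis
      using k 3 low_digits_large[OF p1, of "m - r" s] low_digits_large[OF p1, of m "r + s"]
      by (simp add: add.commute)
  next
    case 4
    let ?c = "low_digits p (r - m mod p) (m div p)"
    have k: "?k = m mod p + p * ?c" using low_digits_large[OF p1] 4 by simp
    then have "?k mod p = m mod p" "?k div p = ?c" using p1 by simp_all
    then have d: "(m - ?k) mod p = 0" "(m - ?k) div p = m div p - ?c" using dm by simp_all
    have "?c + low_digits p s (m div p - ?c) = low_digits p (r - m mod p + s) (m div p)"
      using less.IH[of "m div p" "r - m mod p" s] less.prems 4 p1 digit_sum_rec[OF p1, of m] by auto
    moreover have "low_digits p s (m - ?k) = p * low_digits p s (m div p - ?c)"
      using low_digits_large[OF p1, of "m - ?k" s] d by simp
    moreover have "low_digits p (r + s) m = m mod p + p * low_digits p (r - m mod p + s) (m div p)"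
      using low_digits_large[OF p1, of m "r + s"] 4 by simp
    ultimately show ?thesis using k by (simp flip: add_mult_distrib2)
  qed simp
qed

text \<open>Why \<open>-j\<close> inherits the first slopes of \<open>y\<close>: \<open>j\<close> is
  itself such an initial sum, so its own smallest powers are those of \<open>-y\<close>.\<close>

lemma low_digits_low_digits:
  assumes p: "normalization_semidom_class.prime p" and "r \<le> r'"
  shows "low_digits p r (low_digits p r' m) = low_digits p r m"
  using assms(2)
proof (induction m arbitrary: r r' rule: less_induct)
  case (less m)
  have p1: "1 < p" using p by (rule prime_gt_1_nat)
  consider "m = 0" | "r' \<le> m mod p" | "r \<le> m mod p" "m mod p < r'" "m > 0"
    | "m > 0" "m mod p < r" by linarith
  then show ?case
  proof cases
    case 2
    then have "r' < p" using p1 mod_less_divisor[of p m] by linarith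
    then show ?thesis using 2 less.prems low_digits_small[OF p1, of r' m] low_digits_small[OF p1, of r m]
       low_digits_small[OF p1, of r r'] by simp
  next
    case 3
    have "low_digits p r' m mod p = m mod p" using low_digits_large[OF p1, of m r'] 3 by simp
    then show ?thesis using 3 low_digits_small[OF p1, of r m] low_digits_small[OF p1, of r] by simp
  next
    case 4
    have "low_digits p r' m mod p = m mod p"
        "low_digits p r' m div p = low_digits p (r' - m mod p) (m div p)"
      using low_digits_large[OF p1, of m r'] 4 less.prems p1 by simp_all
    moreover have "low_digits p (r - m mod p) (low_digits p (r' - m mod p) (m div p))
       = low_digits p (r - m mod p) (m div p)"
      using less.IH[of "m div p" "r - m mod p" "r' - m mod p"] 4 less.prems p1 by auto
    ultimately show ?thesis
      using 4 low_digits_large[OF p1, of m r] low_digits_large[OF p1, of "low_digits p r' m" r] by simp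
  qed simp
qed

lemma submask_mod_power:
  assumes p: "normalization_semidom_class.prime p"
  shows "submask p (m mod p ^ N) m"
proof (induction N arbitrary: m)
  case 0
  then show ?case using p by simp
next
  case (Suc N)
  have "m mod p ^ Suc N div p = m div p mod p ^ N" "m mod p ^ Suc N mod p = m mod p"
    by (simp_all add: mod_mult2_eq prime_gt_0_nat[OF p] mod_mod_cancel)
  then show ?case using Suc[of "m div p"] submask_rec[OF p, of "m mod p ^ Suc N" m] by simp
qed

text \<open>Truncation discards only the largest powers. This makes the p-adic version independent
  of the truncation used.\<close>

lemma low_digits_mod_power:
  assumes p: "normalization_semidom_class.prime p" and "r \<le> digit_sum p (m mod p ^ N)"
  shows "low_digits p r (m mod p ^ N) = low_digits p r m"
  using assms(2)
proof (induction N arbitrary: m r)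
  case (Suc N)
  have p1: "1 < p" using p by (rule prime_gt_1_nat)
  have dm: "m mod p ^ Suc N div p = m div p mod p ^ N" "m mod p ^ Suc N mod p = m mod p"
    using p1 by (simp_all add: mod_mult2_eq mod_mod_cancel)
  show ?case
  proof (cases "r \<le> m mod p")
    case True
    then show ?thesis using low_digits_small[OF p1, of r m] low_digits_small[OF p1, of r "m mod p ^ Suc N"] dm by simp
  next
    case False
    have "low_digits p (r - m mod p) (m div p mod p ^ N) = low_digits p (r - m mod p) (m div p)"
      using Suc.prems digit_sum_rec[OF p1, of "m mod p ^ Suc N"] dm by (intro Suc.IH) simp
    then show ?thesis using False dm low_digits_large[OF p1, of m r] 
        low_digits_large[OF p1, of "m mod p ^ Suc N" r] by simp
  qed
qed simp

section \<open>Power sums of polynomials\<close>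

text \<open>Translation by 1 permutes the field, so the sum of its elements absorbs
  \<open>CARD('k)\<close> ones.\<close>

lemma of_nat_card_field: "of_nat CARD('k) = (0 :: 'k::{finite,field})"
proof -
  have "(\<Sum>c\<in>UNIV. c + 1) = (\<Sum>c\<in>UNIV. c :: 'k)"
    by (rule sum.reindex_bij_witness[of _ "\<lambda>c. c - 1" "\<lambda>c. c + 1"]) auto
  then show ?thesis by (simp add: sum.distrib)
qed

lemma CHAR_eq_card:
  assumes "normalization_semidom_class.prime CARD('k::{finite,field})"
  shows "CHAR('k) = CARD('k)"
proof -
  have "CHAR('k) dvd CARD('k)"
    using of_nat_card_field[where ?'k = 'k] by (simp add: of_nat_eq_0_iff_char_dvd)
  then show ?thesis
    using assms by (metis CHAR_not_1 One_nat_def prime_nat_iff)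
qed

text \<open>Multiplication by \<open>x\<close> permutes the nonzero elements, so their product is
  unchanged.\<close>

lemma power_card_field_minus_1:
  fixes x :: "'k::{finite,field}"
  assumes "x \<noteq> 0"
  shows "x ^ (CARD('k) - 1) = 1"
proof -
  let ?U = "UNIV - {0 :: 'k}"
  have "x ^ card ?U * \<Prod>?U = (\<Prod>y\<in>?U. x * y)"
    by (simp add: prod.distrib)
  also have "\<dots> = \<Prod>?U"
    by (rule prod.reindex_bij_witness[of _ "\<lambda>y. y / x" "\<lambda>y. x * y"]) (use assms in auto)
  finally show ?thesis by (simp add: card_Diff_singleton)
qed

lemma sum_power_field:
  "(\<Sum>c\<in>(UNIV :: 'k::{finite,field} set). c ^ k)
    = (if 0 < k \<and> (CARD('k) - 1) dvd k then - 1 else 0)"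
proof -
  let ?q = "CARD('k)"
  have card: "card (UNIV - {0 :: 'k}) = ?q - 1" by (simp add: card_Diff_singleton)
  have q2: "2 \<le> ?q"
    using card_mono[of "UNIV :: 'k set" "{0, 1}"] by simp
  consider "k = 0" | "0 < k" "(?q - 1) dvd k" | "\<not> (?q - 1) dvd k" by blast
  then show ?thesis
  proof cases
    case 1
    \<comment> \<open>As \<open>0 ^ 0 = 1\<close>, the exponent 0 gives \<open>CARD('k)\<close> ones
      and not one fewer; this is why \<open>0 < k\<close> is required for the value -1.\<close>
    then show ?thesis by (simp add: of_nat_card_field)
  next
    case 2
    then obtain l where l: "k = (?q - 1) * l" by blast
    have "(\<Sum>c\<in>UNIV. c ^ k) = (\<Sum>c\<in>UNIV - {0 :: 'k}. c ^ k)"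
      using 2 by (intro sum.mono_neutral_right) auto
    also have "\<dots> = (\<Sum>c\<in>UNIV - {0 :: 'k}. 1)"
      by (rule sum.cong) (auto simp: l power_mult power_card_field_minus_1 simp del: One_nat_def)
    also have "\<dots> = of_nat (?q - 1)" using card by simp
    also have "\<dots> = of_nat ?q - 1" using q2 by (subst of_nat_diff) auto
    finally show ?thesis using 2 by (simp add: of_nat_card_field)
  next
    case 3
    define r where "r = k mod (?q - 1)"
    have r: "0 < r" "r < ?q - 1" using 3 q2 by (auto simp: r_def dvd_eq_mod_eq_0)
    \<comment> \<open>A \<open>g\<close> with \<open>g ^ k\<close> different from 1 makes the sum
      invariant under a nontrivial factor. If none existed, a nonzero polynomial of degree at most
      \<open>r < ?q - 1\<close> would vanish at all \<open>?q - 1\<close> nonzero elements.\<close>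
    have "\<exists>g :: 'k. g \<noteq> 0 \<and> g ^ k \<noteq> 1"
    proof (rule ccontr)
      assume no: "\<not> ?thesis"
      let ?f = "Polynomial.monom 1 r - 1 :: 'k poly"
      have deg: "Polynomial.degree ?f \<le> r"
        by (intro degree_diff_le) (auto simp: degree_monom_eq)
      have "poly.coeff ?f r = 1" using r by (simp add: coeff_1)
      then have f0: "?f \<noteq> 0" by (metis coeff_0 zero_neq_one)
      have "c ^ r = 1" if "c \<noteq> 0" for c :: 'k
      proof -
        have "k = (?q - 1) * (k div (?q - 1)) + r" by (simp add: r_def)
        then have "c ^ k = (c ^ (?q - 1)) ^ (k div (?q - 1)) * c ^ r"
          by (metis power_add power_mult)
        moreover have "c ^ k = 1" using no that by blast
        ultimately show ?thesis using power_card_field_minus_1[OF that] by simp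
      qed
      then have "UNIV - {0} \<subseteq> {c. poly ?f c = 0}" by (auto simp: poly_monom)
      then have "card (UNIV - {0 :: 'k}) \<le> card {c. poly ?f c = 0}"
        by (intro card_mono poly_roots_finite f0)
      also have "\<dots> \<le> Polynomial.degree ?f" by (rule card_poly_roots_bound[OF f0])
      finally show False using deg card r by simp
    qed
    then obtain g :: 'k where g: "g \<noteq> 0" "g ^ k \<noteq> 1" by blast
    have "g ^ k * (\<Sum>c\<in>UNIV. c ^ k) = (\<Sum>c\<in>UNIV. (g * c) ^ k)"
      by (simp add: sum_distrib_left power_mult_distrib)
    also have "\<dots> = (\<Sum>c\<in>UNIV. c ^ k)"
      by (rule sum.reindex_bij_witness[of _ "\<lambda>c. c / g" "\<lambda>c. g * c"]) (use g in auto)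
    finally have "(g ^ k - 1) * (\<Sum>c\<in>UNIV. c ^ k) = 0" by (simp add: algebra_simps)
    then show ?thesis using g 3 by simp
  qed
qed

section \<open>The recursion for power sums over sets of polynomials\<close>

lemma poly_in_K_pCons:
  "poly_in_K (pCons c n) = fls_const c + fls_X_inv * poly_in_K n"
  by (simp add: poly_in_K_def map_poly_pCons)

lemma poly_in_K_0 [simp]: "poly_in_K 0 = 0"
  by (simp add: poly_in_K_def)

lemma poly_in_K_1 [simp]: "poly_in_K 1 = 1"
  by (simp add: poly_in_K_def)

definition power_sum :: "'k::field poly set \<Rightarrow> nat \<Rightarrow> 'k fls" where
  "power_sum F m = (\<Sum>n\<in>F. poly_in_K n ^ m)"

text \<open>The passage from \<open>n\<close> to \<open>c + T n\<close>. Both the monic polynomials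
  of fixed degree and all polynomials of bounded degree arise by iterating it, so one recursion
  serves the coefficients and the trivial zero.\<close>

definition extend_polys :: "'k::field poly set \<Rightarrow> 'k poly set" where
  "extend_polys F = (\<lambda>(c, n). pCons c n) ` (UNIV \<times> F)"

text \<open>Expand \<open>(c + T n) ^ m\<close> binomially and sum over \<open>c\<close> first: the
  power sums of the finite field are -1 or 0 and select the exponents \<open>k\<close>.\<close>

lemma power_sum_extend_polys:
  fixes F :: "'k::{finite,field} poly set"
  shows "power_sum (extend_polys F) m =
    - (\<Sum>k | k \<le> m \<and> 0 < k \<and> (CARD('k) - 1) dvd k.
          of_nat (m choose k) * (fls_X_inv ^ (m - k) * power_sum F (m - k)))"
proof -
  have inj: "inj_on (\<lambda>(c, n). pCons c n) (UNIV \<times> F)" by (auto simp: inj_on_def)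
  let ?g = "\<lambda>k. of_nat (m choose k) * (fls_X_inv ^ (m - k) * power_sum F (m - k))"
  have fls_const_sum: "(\<Sum>c\<in>A. fls_const (f c)) = fls_const (\<Sum>c\<in>A. f c)" for A and f :: "'k \<Rightarrow> 'k"
    by (induction A rule: infinite_finite_induct) (auto simp: fls_plus_const)
  have "power_sum (extend_polys F) m
      = (\<Sum>(c, n)\<in>UNIV \<times> F. (fls_const c + fls_X_inv * poly_in_K n) ^ m)"
    unfolding power_sum_def extend_polys_def
    by (subst sum.reindex[OF inj]) (simp add: case_prod_unfold poly_in_K_pCons)
  also have "\<dots> = (\<Sum>c\<in>UNIV. \<Sum>n\<in>F. \<Sum>k\<le>m.
      fls_const (c ^ k) * (of_nat (m choose k) * (fls_X_inv ^ (m - k) * poly_in_K n ^ (m - k))))"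
    by (simp add: sum.cartesian_product[symmetric] binomial_ring fls_const_power
        power_mult_distrib mult_ac)
  also have "\<dots> = (\<Sum>c\<in>UNIV. \<Sum>k\<le>m. fls_const (c ^ k) * ?g k)"
    by (subst sum.swap[of _ _ F]) (simp add: power_sum_def sum_distrib_left)
  also have "\<dots> = (\<Sum>k\<le>m. fls_const (\<Sum>c\<in>UNIV. c ^ k) * ?g k)"
    by (subst sum.swap) (simp add: fls_const_sum sum_distrib_right[symmetric])
  also have "\<dots> = (\<Sum>k\<le>m. if 0 < k \<and> (CARD('k) - 1) dvd k then - ?g k else 0)"
    by (rule sum.cong) (auto simp: sum_power_field fls_const_uminus[symmetric])
  also have "\<dots> = (\<Sum>k | k \<le> m \<and> 0 < k \<and> (CARD('k) - 1) dvd k. - ?g k)"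
    by (subst sum.inter_filter[symmetric]) (auto intro!: sum.cong)
  finally show ?thesis by (simp add: sum_negf)
qed

definition monics :: "nat \<Rightarrow> 'k::field poly set" where
  "monics i = {n. Polynomial.lead_coeff n = 1 \<and> Polynomial.degree n = i}"

lemma monics_0: "monics 0 = {1}"
  by (auto simp: monics_def elim!: degree_eq_zeroE simp: one_pCons)

lemma monics_Suc: "monics (Suc i) = extend_polys (monics i :: 'k::field poly set)"
proof
  show "monics (Suc i) \<subseteq> extend_polys (monics i :: 'k poly set)"
  proof
    fix n :: "'k poly"
    assume n: "n \<in> monics (Suc i)"
    obtain c n' where [simp]: "n = pCons c n'" by (rule pCons_cases)
    from n have "n' \<noteq> 0" by (auto simp: monics_def)
    with n have "n' \<in> monics i" by (auto simp: monics_def)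
    then show "n \<in> extend_polys (monics i)" by (auto simp: extend_polys_def)
  qed
  show "extend_polys (monics i) \<subseteq> (monics (Suc i) :: 'k poly set)"
    by (auto simp: extend_polys_def monics_def)
qed

definition polys_below :: "nat \<Rightarrow> 'k::field poly set" where
  "polys_below d = {n. n = 0 \<or> Polynomial.degree n < d}"

lemma polys_below_0: "polys_below 0 = {0}"
  by (auto simp: polys_below_def)

lemma polys_below_Suc: "polys_below (Suc d) = extend_polys (polys_below d :: 'k::field poly set)"
proof
  show "polys_below (Suc d) \<subseteq> extend_polys (polys_below d :: 'k poly set)"
  proof
    fix n :: "'k poly"
    assume n: "n \<in> polys_below (Suc d)"
    obtain c n' where [simp]: "n = pCons c n'" by (rule pCons_cases)
    from n have "n' \<in> polys_below d" by (auto simp: polys_below_def split: if_splits)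
    then show "n \<in> extend_polys (polys_below d)" by (auto simp: extend_polys_def)
  qed
  show "extend_polys (polys_below d) \<subseteq> (polys_below (Suc d) :: 'k poly set)"
    by (auto simp: extend_polys_def polys_below_def split: if_splits)
qed

lemma finite_extend_polys: "finite F \<Longrightarrow> finite (extend_polys (F :: 'k::{finite,field} poly set))"
  by (simp add: extend_polys_def)

lemma finite_monics [simp]: "finite (monics i :: 'k::{finite,field} poly set)"
  by (induction i) (simp_all add: monics_0 monics_Suc finite_extend_polys)

lemma finite_polys_below [simp]: "finite (polys_below i :: 'k::{finite,field} poly set)"
  by (induction i) (simp_all add: polys_below_0 polys_below_Suc finite_extend_polys)

lemma of_nat_choose_fls_eq_0_iff:
  assumes p: "normalization_semidom_class.prime CARD('k::{finite,field})"
  shows "of_nat (m choose k) = (0 :: 'k fls) \<longleftrightarrow> \<not> submask CARD('k) k m"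
  using CHAR_eq_card[OF p] by (simp add: submask_def of_nat_eq_0_iff_char_dvd)

lemma pred_le_digit_sum:
  assumes "1 < p" "0 < k" "(p - 1) dvd k"
  shows "p - 1 \<le> digit_sum p k"
  using assms dvd_pred_iff_digit_sum[of p k] digit_sum_eq_0_iff[of p k]
  by (intro dvd_imp_le) auto

text \<open>
  If \<open>m choose k\<close> is prime to \<open>p\<close>, then the digits of \<open>m\<close> split into those of \<open>k\<close> and \<open>m - k\<close>, and
  a positive multiple \<open>k\<close> of \<open>p - 1\<close> takes at least \<open>p - 1\<close> of the digit sum.
\<close>

lemma power_sum_extend_polys_eq_0:
  fixes F :: "'k::{finite,field} poly set"
  defines "p \<equiv> CARD('k)"
  assumes p: "normalization_semidom_class.prime p"
    and F: "\<And>m. digit_sum p m < r \<Longrightarrow> power_sum F m = 0"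
    and m: "digit_sum p m < r + (p - 1)"
  shows "power_sum (extend_polys F) m = 0"
proof -
  have p1: "1 < p" using p by (rule prime_gt_1_nat)
  have "of_nat (m choose k) * (fls_X_inv ^ (m - k) * power_sum F (m - k)) = 0"
    if "k \<le> m" "0 < k" "(p - 1) dvd k" for k
  proof (cases "submask p k m")
    case True
    have "digit_sum p (m - k) < r"
      using digit_sum_submask[OF p True] pred_le_digit_sum[OF p1 that(2,3)] m by simp
    then show ?thesis using F by simp
  next
    case False
    then show ?thesis
      using of_nat_choose_fls_eq_0_iff[of m k, where ?'k = 'k] p by (simp add: p_def)
  qed
  then show ?thesis
    unfolding power_sum_extend_polys p_def[symmetric] neg_equal_0_iff_equal
    by (intro sum.neutral) auto
qed

lemma power_sum_monics_eq_0:
  assumes p: "normalization_semidom_class.prime CARD('k::{finite,field})"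
    and "digit_sum CARD('k) m < i * (CARD('k) - 1)"
  shows "power_sum (monics i :: 'k poly set) m = 0"
  using assms(2)
proof (induction i arbitrary: m)
  case (Suc i)
  show ?case unfolding monics_Suc
    by (rule power_sum_extend_polys_eq_0[OF p Suc.IH])
      (use Suc.prems in \<open>simp_all only: mult_Suc add.commute[of "CARD('k) - 1"]\<close>)
qed simp

lemma power_sum_polys_below_eq_0:
  assumes p: "normalization_semidom_class.prime CARD('k::{finite,field})"
    and "digit_sum CARD('k) m < i * (CARD('k) - 1)"
  shows "power_sum (polys_below i :: 'k poly set) m = 0"
  using assms(2)
proof (induction i arbitrary: m)
  case (Suc i)
  show ?case unfolding polys_below_Suc
    by (rule power_sum_extend_polys_eq_0[OF p Suc.IH])
      (use Suc.prems in \<open>simp_all only: mult_Suc add.commute[of "CARD('k) - 1"]\<close>)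
qed simp

text \<open>The sum of the first \<open>i\<close> slopes, hence the expected height of the
  \<open>i\<close>-th Newton point.\<close>

definition low_block_sum :: "nat \<Rightarrow> nat \<Rightarrow> nat \<Rightarrow> nat" where
  "low_block_sum p i m = (\<Sum>t=1..i. low_digits p (t * (p - 1)) m)"

lemma low_block_sum_Suc':
  "low_block_sum p (Suc i) m
    = low_digits p (p - 1) m + (\<Sum>t=1..i. low_digits p ((p - 1) + t * (p - 1)) m)"
  by (induction i) (simp_all add: low_block_sum_def)

text \<open>The right-hand side is the valuation of the \<open>k\<close>-th term of the recursion,
  raised by \<open>Suc i * m\<close>. Its \<open>Suc i\<close> copies of \<open>k\<close> are
  distributed: one is compared with the first slope, and each other one joins a slope of
  \<open>m - k\<close> to form a subsum of \<open>m\<close> with at least \<open>p - 1\<close> more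
  powers, to which \<open>low_digits_le\<close> applies.\<close>

lemma low_block_sum_diff:
  assumes p: "normalization_semidom_class.prime p"
    and k: "submask p k m" "p - 1 \<le> digit_sum p k"
    and i: "i * (p - 1) \<le> digit_sum p (m - k)"
  shows "low_block_sum p (Suc i) m \<le> low_block_sum p i (m - k) + Suc i * k" 
    and "k \<noteq> low_digits p (p - 1) m \<Longrightarrow> low_block_sum p (Suc i) m < low_block_sum p i (m - k) + Suc i * k"
    and "k = low_digits p (p - 1) m \<Longrightarrow> low_block_sum p (Suc i) m = low_block_sum p i (m - k) + Suc i * k"
proof -
  let ?l = "low_block_sum p (Suc i) m" and ?r = "low_block_sum p i (m - k) + Suc i * k"
  let ?s = "\<Sum>t=1..i. low_digits p ((p - 1) + t * (p - 1)) m"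
  have ti: "t * (p - 1) \<le> digit_sum p (m - k)" if "t \<in> {1..i}" for t
    using i that by (meson atLeastAtMost_iff le_trans mult_le_mono1)
  have r: "?r = k + (\<Sum>t=1..i. low_digits p (t * (p - 1)) (m - k) + k)"
    by (simp add: low_block_sum_def sum.distrib)
  have "?s \<le> (\<Sum>t=1..i. low_digits p (t * (p - 1)) (m - k) + k)"
  proof (rule sum_mono)
    fix t assume t: "t \<in> {1..i}"
    note sub = submask_low_digits[OF p ti[OF t]]
    show "low_digits p ((p - 1) + t * (p - 1)) m \<le> low_digits p (t * (p - 1)) (m - k) + k"
      using submask_add[OF p k(1) sub(1)] sub(2) k(2)
      by (intro low_digits_le[OF p]) (simp_all add: add.commute)
  qed
  moreover have "low_digits p (p - 1) m \<le> k" by (rule low_digits_le[OF p k])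
  ultimately show "?l \<le> ?r" "k \<noteq> low_digits p (p - 1) m \<Longrightarrow> ?l < ?r"
    unfolding r low_block_sum_Suc' by linarith+
  show "?l = ?r" if eq: "k = low_digits p (p - 1) m"
  proof -
    have "low_digits p ((p - 1) + t * (p - 1)) m = low_digits p (t * (p - 1)) (m - k) + k"
      if t: "t \<in> {1..i}" for t
    proof -
      have "(p - 1) + t * (p - 1) \<le> digit_sum p m"
        using ti[OF t] digit_sum_submask[OF p k(1)] k(2) by simp
      from low_digits_add[OF p this] eq show ?thesis by simp
    qed
    then show ?thesis unfolding r low_block_sum_Suc' using eq by simp
  qed
qed

text \<open>In the recursion the term of \<open>k0\<close>, the \<open>p - 1\<close> smallest powers
  of \<open>m\<close>, has strictly least valuation, so nothing can cancel it.\<close>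

lemma power_sum_monics_subdegree:
  fixes i m :: nat
  defines "p \<equiv> CARD('k::{finite,field})"
  assumes p: "normalization_semidom_class.prime p" and "i * (p - 1) \<le> digit_sum p m"
  shows "power_sum (monics i :: 'k poly set) m \<noteq> 0 \<and>
    fls_subdegree (power_sum (monics i :: 'k poly set) m) = int (low_block_sum p i m) - int (i * m)"
  using assms(3)
proof (induction i arbitrary: m)
  case 0
  then show ?case by (simp add: monics_0 power_sum_def low_block_sum_def)
next
  case (Suc i)
  have p1: "1 < p" using p by (rule prime_gt_1_nat)
  let ?M = "monics i :: 'k poly set"
  define K where "K = {k. k \<le> m \<and> 0 < k \<and> (p - 1) dvd k}"
  define g where "g k = of_nat (m choose k) * (fls_X_inv ^ (m - k) * power_sum ?M (m - k))" for k
  define v where "v = int (low_block_sum p (Suc i) m) - int (Suc i * m)"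
  define k0 where "k0 = low_digits p (p - 1) m"
  have val: "g k \<noteq> 0 \<and> fls_subdegree (g k) = int (low_block_sum p i (m - k) + Suc i * k) - int (Suc i * m)"
    if "submask p k m" "i * (p - 1) \<le> digit_sum p (m - k)" for k
  proof -
    have "k \<le> m" using submask_le that by blast
    note IH = Suc.IH[OF that(2)]
    have "of_nat (m choose k) \<noteq> (0 :: 'k fls)"
      using of_nat_choose_fls_eq_0_iff[of m k, where ?'k = 'k] p that by (simp add: p_def)
    then show ?thesis
      unfolding g_def using IH \<open>k \<le> m\<close>
      by (simp add: of_nat_diff algebra_simps)
  qed
  have g0: "g k = 0 \<or> v < fls_subdegree (g k)" if "k \<in> K" "k \<noteq> k0" for k
  proof -
    have k: "k \<le> m" "0 < k" "(p - 1) dvd k" using that by (auto simp: K_def)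
    consider "\<not> submask p k m" | "digit_sum p (m - k) < i * (p - 1)"
      | "submask p k m" "i * (p - 1) \<le> digit_sum p (m - k)" by linarith
    then show ?thesis
    proof cases
      case 1
      then show ?thesis
        using of_nat_choose_fls_eq_0_iff[of m k, where ?'k = 'k] p by (simp add: p_def g_def)
    next
      case 2
      then show ?thesis using power_sum_monics_eq_0[of "m - k" i, where ?'k = 'k] p
        by (simp add: p_def g_def)
    next
      case 3
      have "low_block_sum p (Suc i) m < low_block_sum p i (m - k) + Suc i * k"
        using low_block_sum_diff(2)[OF p 3(1) pred_le_digit_sum[OF p1 k(2,3)] 3(2)] that(2)
        unfolding k0_def by blast
      then show ?thesis using val[OF 3] unfolding v_def by linarith
    qed
  qed
  have "p - 1 \<le> digit_sum p m" using Suc.prems by simp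
  note k0 = submask_low_digits[OF p this, folded k0_def]
  have k0_0: "0 < k0" using k0(2) p1 by (cases k0) auto
  have dk0: "i * (p - 1) \<le> digit_sum p (m - k0)"
    using digit_sum_submask[OF p k0(1)] k0(2) Suc.prems by simp
  \<comment> \<open>The digit sum of \<open>k0\<close> is \<open>p - 1\<close>, so
    \<open>p - 1\<close> divides \<open>k0\<close> itself.\<close>
  have k0K: "k0 \<in> K"
    unfolding K_def using submask_le[OF k0(1)] k0_0 k0(2) dvd_pred_iff_digit_sum[OF p1, of k0] by simp
  have gk0: "g k0 \<noteq> 0" "fls_subdegree (g k0) = v"
    using val[OF k0(1) dk0] low_block_sum_diff(3)[OF p k0(1) _ dk0] k0(2)
    by (simp_all add: k0_def v_def)
  have [simp]: "finite K" by (simp add: K_def)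
  \<comment> \<open>Up to and including position \<open>v\<close> only the term of \<open>k0\<close>
    contributes.\<close>
  have nth: "fls_nth (sum g K) n = fls_nth (g k0) n" if "n \<le> v" for n
  proof -
    have "fls_nth (sum g K) n = (\<Sum>k\<in>K. fls_nth (g k) n)" by (simp add: fls_nth_sum)
    also have "\<dots> = (\<Sum>k\<in>{k0}. fls_nth (g k) n)"
    proof (rule sum.mono_neutral_right)
      show "\<forall>k\<in>K - {k0}. fls_nth (g k) n = 0"
        using g0 that by (metis DiffE fls_eq0_below_subdegree fls_zero_nth insertI1 le_less_trans)
    qed (use k0K in auto)
    finally show ?thesis by simp
  qed
  have "fls_nth (sum g K) v \<noteq> 0" using nth[of v] gk0 nth_fls_subdegree_nonzero by force
  moreover from this have "fls_subdegree (sum g K) = v"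
    by (rule fls_subdegree_eqI) (use nth gk0 in auto)
  moreover have "power_sum (monics (Suc i)) m = - sum g K"
    unfolding monics_Suc power_sum_extend_polys p_def[symmetric] K_def g_def ..
  ultimately show ?case unfolding v_def by auto
qed

text \<open>Every nonzero polynomial is a unit times a monic one, and the unit disappears in the power.\<close>

lemma power_sum_polys_below_eq_sum_monics:
  assumes "0 < j" "(CARD('k::{finite,field}) - 1) dvd j"
  shows "power_sum (polys_below d :: 'k poly set) j = - (\<Sum>i<d. power_sum (monics i) j)"
proof (induction d)
  case 0
  then show ?case using assms by (simp add: polys_below_0 power_sum_def)
next
  case (Suc d)
  let ?U = "UNIV - {0 :: 'k}"
  let ?h = "\<lambda>(c, n). Polynomial.smult c n :: 'k poly"
  have split: "polys_below (Suc d) = polys_below d \<union> ?h ` (?U \<times> monics d)" (is "_ = _ \<union> ?R")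
  proof (intro equalityI subsetI)
    fix n :: "'k poly"
    assume n: "n \<in> polys_below (Suc d)"
    show "n \<in> polys_below d \<union> ?R"
    proof (cases "n = 0 \<or> Polynomial.degree n < d")
      case False
      let ?c = "Polynomial.lead_coeff n"
      have "?c \<noteq> 0" "Polynomial.degree n = d" using False n by (auto simp: polys_below_def)
      then have "Polynomial.smult (inverse ?c) n \<in> monics d" "n = Polynomial.smult ?c (Polynomial.smult (inverse ?c) n)"
        by (auto simp: monics_def)
      then have "n \<in> ?R" using \<open>?c \<noteq> 0\<close> by (auto intro!: image_eqI[of _ _ "(?c, Polynomial.smult (inverse ?c) n)"])
      then show ?thesis by simp
    qed (auto simp: polys_below_def)
  qed (auto simp: polys_below_def monics_def split: if_splits)
  have disj: "polys_below d \<inter> ?R = {}"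
    by (auto simp: polys_below_def monics_def split: if_splits)
  have inj: "inj_on ?h (?U \<times> monics d)"
  proof (rule inj_onI)
    fix x x' assume "x \<in> ?U \<times> monics d" "x' \<in> ?U \<times> monics d" "?h x = ?h x'"
    then obtain c c' n n' where [simp]: "x = (c, n)" "x' = (c', n')"
      and *: "n \<in> monics d" "n' \<in> monics d" "c \<noteq> 0"
        "Polynomial.smult c n = Polynomial.smult c' n'"
      by auto
    have "Polynomial.lead_coeff (Polynomial.smult c n) = c"
      "Polynomial.lead_coeff (Polynomial.smult c' n') = c'"
      unfolding lead_coeff_smult using *(1,2) by (auto simp: monics_def)
    then have "c = c'" using *(4) by metis
    moreover have "n = n'"
      using *(3,4) \<open>c = c'\<close> by (metis left_inverse smult_1_left smult_smult)
    ultimately show "x = x'" by simp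
  qed
  obtain l where l: "j = (CARD('k) - 1) * l" using assms by blast
  have smult: "poly_in_K (Polynomial.smult c n) ^ j = poly_in_K n ^ j" if "c \<noteq> 0" for c :: 'k and n
  proof -
    have eq: "poly_in_K (Polynomial.smult c n) = fls_const c * poly_in_K n"
      by (induction n) (simp_all add: poly_in_K_pCons algebra_simps)
    have "c ^ j = 1" using that
      by (simp add: l power_mult power_card_field_minus_1 del: One_nat_def)
    then show ?thesis by (simp add: eq power_mult_distrib fls_const_power[symmetric])
  qed
  have "power_sum (polys_below (Suc d)) j = power_sum (polys_below d) j + (\<Sum>x\<in>?R. poly_in_K x ^ j)"
    unfolding power_sum_def split by (rule sum.union_disjoint) (use disj in auto)
  also have "(\<Sum>x\<in>?R. poly_in_K x ^ j) = (\<Sum>(c, n)\<in>?U \<times> monics d. poly_in_K n ^ j)"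
    unfolding sum.reindex[OF inj] o_def
    by (rule sum.cong) (simp_all add: case_prod_unfold smult mem_Times_iff)
  also have "\<dots> = of_nat (card ?U) * power_sum (monics d) j"
    by (simp add: sum.cartesian_product[symmetric] power_sum_def)
  \<comment> \<open>The number of units is -1 in characteristic \<open>p\<close>; this is the sign
    in the statement.\<close>
  also have "of_nat (card ?U) = (of_nat CARD('k) - 1 :: 'k fls)"
    by (subst card_Diff_singleton) (simp_all add: of_nat_diff)
  also have "of_nat CARD('k) = (0 :: 'k fls)"
    using of_nat_card_field[where ?'k = 'k] by (simp add: fls_of_nat)
  finally show ?case using Suc.IH by simp
qed

text \<open>For large \<open>d\<close> this finite sum is the value of the zeta function at its
  trivial zero.\<close>

lemma sum_power_sum_monics_eq_0:
  assumes p: "normalization_semidom_class.prime CARD('k::{finite,field})"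
    and "0 < j" "(CARD('k) - 1) dvd j" "digit_sum CARD('k) j < d * (CARD('k) - 1)"
  shows "(\<Sum>i<d. power_sum (monics i :: 'k poly set) j) = 0"
  using power_sum_polys_below_eq_0[OF p assms(4)] power_sum_polys_below_eq_sum_monics[OF assms(2,3), of d]
  by simp

section \<open>The coefficients of the zeta function\<close>

lemma fls_one_unit_power:
  fixes u :: "'a::field fls"
  assumes "fls_subdegree u = 0" "fls_nth u 0 = 1"
  shows "fls_subdegree (u ^ n) = 0" "fls_nth (u ^ n) 0 = 1"
  using assms fls_pow_base[of u n] by (simp_all add: fls_subdegree_pow)

text \<open>By the Frobenius identity \<open>u ^ (p ^ N * k) - 1\<close> is the
  \<open>p ^ N\<close>-th power of \<open>u ^ k - 1\<close>, whose valuation is at least 1 unless it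
  is 0.\<close>

lemma one_unit_power_prime_power:
  fixes u :: "'k::{finite,field} fls"
  defines "p \<equiv> CARD('k)"
  assumes p: "normalization_semidom_class.prime p"
    and u: "fls_subdegree u = 0" "fls_nth u 0 = 1"
    and n: "n < int (p ^ N)"
  shows "fls_nth (u ^ (p ^ N * k) - 1) n = 0"
proof -
  let ?v = "u ^ k - 1"
  have "u ^ (p ^ N * k) = (1 + ?v) ^ (p ^ N)"
    by (simp add: power_mult mult.commute)
  also have "\<dots> = 1 + ?v ^ (p ^ N)"
    using freshmans_dream'[where ?'a = "'k fls", of "p ^ N" N 1 ?v] p CHAR_eq_card[where ?'k = 'k]
    by (simp add: p_def)
  finally have "fls_nth (u ^ (p ^ N * k) - 1) n = fls_nth (?v ^ (p ^ N)) n" by simp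
  also have "\<dots> = 0"
  proof (cases "?v = 0")
    case True
    then show ?thesis using prime_gt_0_nat[OF p] by (simp add: power_0_left)
  next
    case False
    have "1 \<le> fls_subdegree ?v"
    proof (rule fls_subdegree_geI[OF False])
      fix l :: int assume "l < 1"
      then consider "l = 0" | "l < 0" by linarith
      then show "fls_nth ?v l = 0"
        using fls_one_unit_power[OF u, of k] by cases simp_all
    qed
    then have "int (p ^ N) * 1 \<le> int (p ^ N) * fls_subdegree ?v" by (intro mult_left_mono) auto
    then show ?thesis using n by (intro fls_pow_nth_below_subdegree) simp
  qed
  finally show ?thesis .
qed

lemma padic_ints_mod:
  assumes "z \<in> padic_ints p" "N \<le> M"
  shows "z M mod int p ^ N = z N"
  using assms(2)
proof (induction M rule: dec_induct)
  case base
  then show ?case using assms by (auto simp: padic_ints_def)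
next
  case (step M)
  have "z (Suc M) mod int p ^ N = z (Suc M) mod int p ^ M mod int p ^ N"
    using step by (simp add: mod_mod_cancel le_imp_power_dvd)
  also have "z (Suc M) mod int p ^ M = z M" using assms by (auto simp: padic_ints_def)
  finally show ?case using step by simp
qed

lemma padic_ints_nonneg: "z \<in> padic_ints p \<Longrightarrow> 0 \<le> z N"
  by (auto simp: padic_ints_def)

lemma nat_padic_mod:
  assumes "z \<in> padic_ints p" "N \<le> M"
  shows "nat (z N) = nat (z M) mod p ^ N"
  using padic_ints_mod[OF assms] padic_ints_nonneg[OF assms(1), of M]
  by (metis nat_int nat_mod_distrib of_nat_0_le_iff of_nat_power)

lemma padic_uminus_in_padic_ints:
  assumes "y \<in> padic_ints p" "0 < p"
  shows "padic_uminus p y \<in> padic_ints p"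
proof -
  have "(- y (Suc n)) mod int p ^ Suc n mod int p ^ n = (- y n) mod int p ^ n" for n
  proof -
    have "(- y (Suc n)) mod int p ^ Suc n mod int p ^ n = (- y (Suc n)) mod int p ^ n"
      by (rule mod_mod_cancel) (simp add: le_imp_power_dvd)
    also have "\<dots> = (- (y (Suc n) mod int p ^ n)) mod int p ^ n" by (simp add: mod_minus_eq)
    also have "y (Suc n) mod int p ^ n = y n" using assms by (auto simp: padic_ints_def)
    finally show ?thesis .
  qed
  then show ?thesis using assms unfolding padic_ints_def padic_uminus_def by simp
qed

text \<open>Exponents congruent modulo \<open>p ^ N\<close> give powers that agree below position
  \<open>p ^ N\<close>. Hence the limit exists and its coefficients can be read off at a finite
  stage.\<close>

lemma one_unit_power_nth:
  fixes u :: "'k::{finite,field} fls"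
  defines "p \<equiv> CARD('k)"
  assumes p: "normalization_semidom_class.prime p"
    and u: "fls_subdegree u = 0" "fls_nth u 0 = 1"
    and z: "z \<in> padic_ints p"
    and n: "n < int (p ^ N)"
  shows "fls_nth (one_unit_power u z) n = fls_nth (u ^ nat (z N)) n"
proof -
  have p1: "1 < p" using p by (rule prime_gt_1_nat)
  note sub = fls_one_unit_power(1)[OF u]
  have le: "fls_nth (u ^ nat (z M)) n = fls_nth (u ^ nat (z N)) n"
    if "N \<le> M" "n < int (p ^ N)" for M N n
  proof -
    define k where "k = nat (z M) div p ^ N"
    have "nat (z M) = nat (z N) + p ^ N * k"
      using nat_padic_mod[OF z \<open>N \<le> M\<close>] by (simp add: k_def)
    then have eq: "u ^ nat (z M) - u ^ nat (z N) = u ^ nat (z N) * (u ^ (p ^ N * k) - 1)"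
      by (simp add: power_add algebra_simps)
    have "fls_nth (u ^ nat (z N) * (u ^ (p ^ N * k) - 1)) n = 0"
    proof (cases "u ^ (p ^ N * k) - 1 = 0")
      case False
      have "int (p ^ N) \<le> fls_subdegree (u ^ (p ^ N * k) - 1)"
        using False one_unit_power_prime_power[OF p[unfolded p_def] u]
        by (intro fls_subdegree_geI) (simp_all add: p_def)
      then show ?thesis using that(2) sub by (intro fls_times_nth_eq0) simp
    qed simp
    then show ?thesis using eq by (metis eq_iff_diff_eq_0 fls_minus_nth)
  qed
  have eq: "fls_nth (u ^ nat (z M)) n = fls_nth (u ^ nat (z N)) n"
    if "n < int (p ^ M)" "n < int (p ^ N)" for M N n
    using le[of M N n] le[of N M n] that by (cases "N \<le> M") auto
  \<comment> \<open>The candidate limit takes its coefficient \<open>n\<close> from stage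
    \<open>Suc n\<close>, which is late enough because \<open>n < p ^ Suc n\<close>.\<close>
  define L where "L = fps_to_fls (Abs_fps (\<lambda>n. fls_nth (u ^ nat (z (Suc n))) (int n)))"
  have L: "fls_nth L n = fls_nth (u ^ nat (z N)) n" if "n < int (p ^ N)" for n N
  proof (cases "n < 0")
    case True
    then show ?thesis using sub by (simp add: L_def)
  next
    case False
    then have "fls_nth L n = fls_nth (u ^ nat (z (Suc (nat n)))) n" by (simp add: L_def)
    also have "\<dots> = fls_nth (u ^ nat (z N)) n"
    proof (rule eq[OF _ that])
      have "Suc (nat n) < p ^ Suc (nat n)" using p1 by (intro power_gt_expt) simp
      then show "n < int (p ^ Suc (nat n))" using False by linarith
    qed
    finally show ?thesis .
  qed
  \<comment> \<open>Distances of Laurent series are powers of 1/2 with the subdegree as exponent,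
    and here the subdegree is at least \<open>p ^ N\<close>, hence more than
    \<open>N\<close>.\<close>
  have "dist (u ^ nat (z N)) L \<le> (1 / 2) ^ N" for N
  proof (cases "u ^ nat (z N) = L")
    case False
    then have sd: "int (p ^ N) \<le> fls_subdegree (u ^ nat (z N) - L)"
      using L by (intro fls_subdegree_geI) auto
    have "0 \<le> int (p ^ N)" by (rule of_nat_0_le_iff)
    with sd have sd0: "0 \<le> fls_subdegree (u ^ nat (z N) - L)" by (rule order_trans[rotated])
    have "N < p ^ N" using p1 by (intro power_gt_expt) simp
    then have "N \<le> nat (fls_subdegree (u ^ nat (z N) - L))" using sd by linarith
    then have "inverse (2 ^ nat (fls_subdegree (u ^ nat (z N) - L))) \<le> (inverse (2 ^ N) :: real)"
      by (intro le_imp_inverse_le power_increasing) auto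
    then show ?thesis
      using False sd0 by (simp add: dist_fls_def power_one_over inverse_eq_divide)
  qed simp
  then have "eventually (\<lambda>N. norm (dist (u ^ nat (z N)) L) \<le> (1 / 2) ^ N) sequentially" by simp
  moreover have "(\<lambda>N. (1 / 2 :: real) ^ N) \<longlonglongrightarrow> 0" by (rule LIMSEQ_realpow_zero) auto
  ultimately have "(\<lambda>N. dist (u ^ nat (z N)) L) \<longlonglongrightarrow> 0" by (rule Lim_null_comparison)
  then have "(\<lambda>N. u ^ nat (z N)) \<longlonglongrightarrow> L" by (rule iffD2[OF tendsto_dist_iff])
  then have "one_unit_power u z = L" unfolding one_unit_power_def by (rule limI)
  then show ?thesis using L[OF n] by simp
qed

lemma poly_in_K_monic:
  assumes "n \<in> monics i"
  shows "fls_nth (poly_in_K n) (- int i) = 1" "fls_subdegree (poly_in_K n) = - int i"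
proof -
  have "fls_nth (poly_in_K n) (- int i) = 1 \<and> (\<forall>l < - int i. fls_nth (poly_in_K n) l = 0)"
    using assms
  proof (induction i arbitrary: n)
    case 0
    then show ?case by (simp add: monics_0)
  next
    case (Suc i)
    then obtain c n' where n: "n = pCons c n'" "n' \<in> monics i"
      by (auto simp: monics_Suc extend_polys_def)
    from Suc.IH[OF n(2)] show ?case
      by (auto simp: n poly_in_K_pCons fls_X_inv_times_conv_shift(1))
  qed
  then show "fls_nth (poly_in_K n) (- int i) = 1" "fls_subdegree (poly_in_K n) = - int i"
    by (auto intro!: fls_subdegree_eqI)
qed

lemma one_unit_part_monic:
  assumes \<pi>: "positive_uniformizer \<pi>" and n: "n \<in> monics i"
  shows "fls_subdegree (one_unit_part \<pi> n) = 0" "fls_nth (one_unit_part \<pi> n) 0 = 1"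
proof -
  have d: "Polynomial.degree n = i" using n by (simp add: monics_def)
  have P: "poly_in_K n \<noteq> 0" using poly_in_K_monic(1)[OF n] by auto
  have \<pi>i: "\<pi> ^ i \<noteq> 0" "fls_subdegree (\<pi> ^ i) = int i" "fls_nth (\<pi> ^ i) (int i) = 1"
    using \<pi> fls_pow_base[of \<pi> i] unfolding positive_uniformizer_def
    by (auto simp add: fls_subdegree_pow simp del: fls_pow_base)
  show "fls_subdegree (one_unit_part \<pi> n) = 0"
    unfolding one_unit_part_def d using \<pi>i P poly_in_K_monic(2)[OF n] by simp
  show "fls_nth (one_unit_part \<pi> n) 0 = 1"
    unfolding one_unit_part_def d
    using fls_times_base[of "\<pi> ^ i" "poly_in_K n"] \<pi>i poly_in_K_monic[OF n] by simp
qed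

text \<open>The bridge from p-adic exponents to the power sums: below precision \<open>p ^ N\<close>
  only the residue of \<open>-y\<close> modulo \<open>p ^ N\<close> matters.\<close>

lemma zeta_coeff_nth:
  fixes \<pi> :: "'k::{finite,field} fls" and y :: "nat \<Rightarrow> int"
  defines "p \<equiv> CARD('k)"
  defines "z \<equiv> padic_uminus p y"
  assumes p: "normalization_semidom_class.prime p" and \<pi>: "positive_uniformizer \<pi>"
    and y: "y \<in> padic_ints p" and l: "l < int (p ^ N)"
  shows "fls_nth (zeta_coeff \<pi> y i) l
    = fls_nth (\<pi> ^ (i * nat (z N)) * power_sum (monics i) (nat (z N))) l"
proof -
  have z: "z \<in> padic_ints CARD('k)"
    unfolding z_def p_def using padic_uminus_in_padic_ints[OF y] prime_gt_0_nat[OF p] by (simp add: p_def)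
  have "fls_nth (zeta_coeff \<pi> y i) l
      = (\<Sum>n\<in>monics i. fls_nth (one_unit_power (one_unit_part \<pi> n) z) l)"
    unfolding zeta_coeff_def monics_def z_def p_def by (simp add: fls_nth_sum)
  also have "\<dots> = (\<Sum>n\<in>monics i. fls_nth (one_unit_part \<pi> n ^ nat (z N)) l)"
    using one_unit_power_nth[OF p[unfolded p_def] one_unit_part_monic[OF \<pi>] z l[unfolded p_def]]
    by (intro sum.cong) auto
  also have "\<dots> = fls_nth (\<Sum>n\<in>monics i. one_unit_part \<pi> n ^ nat (z N)) l"
    by (simp add: fls_nth_sum)
  also have "(\<Sum>n\<in>monics i. one_unit_part \<pi> n ^ nat (z N))
      = (\<Sum>n\<in>monics i. \<pi> ^ (i * nat (z N)) * poly_in_K n ^ nat (z N))"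
    by (rule sum.cong)
      (auto simp: monics_def one_unit_part_def power_mult_distrib power_mult)
  also have "\<dots> = \<pi> ^ (i * nat (z N)) * power_sum (monics i) (nat (z N))"
    by (simp add: power_sum_def sum_distrib_left)
  finally show ?thesis .
qed

text \<open>A p-adic integer may have infinite digit sum, so only the comparison with
  \<open>r\<close> is defined, through truncations.\<close>

definition padic_digit_count_ge :: "nat \<Rightarrow> nat \<Rightarrow> (nat \<Rightarrow> int) \<Rightarrow> bool" where
  "padic_digit_count_ge p r z \<longleftrightarrow> (\<exists>N. r \<le> digit_sum p (nat (z N)))"

text \<open>Any truncation with digit sum at least \<open>r\<close> gives the same value by
  \<open>padic_low_digits_eq\<close>. The value is meaningful only if one exists.\<close>

definition padic_low_digits :: "nat \<Rightarrow> nat \<Rightarrow> (nat \<Rightarrow> int) \<Rightarrow> nat" where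
  "padic_low_digits p r z = low_digits p r (nat (z (LEAST N. r \<le> digit_sum p (nat (z N)))))"

lemma padic_digit_sum_mono:
  assumes p: "normalization_semidom_class.prime p" and z: "z \<in> padic_ints p" and "N \<le> M"
  shows "digit_sum p (nat (z N)) \<le> digit_sum p (nat (z M))"
  using digit_sum_submask[OF p submask_mod_power[OF p, of "nat (z M)" N]] nat_padic_mod[OF z \<open>N \<le> M\<close>]
  by simp

lemma padic_low_digits_eq:
  assumes p: "normalization_semidom_class.prime p" and z: "z \<in> padic_ints p"
    and N: "r \<le> digit_sum p (nat (z N))"
  shows "padic_low_digits p r z = low_digits p r (nat (z N))"
proof -
  let ?M = "LEAST N. r \<le> digit_sum p (nat (z N))"
  have M: "r \<le> digit_sum p (nat (z ?M))" using N by (rule LeastI)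
  have eq: "nat (z ?M) = nat (z N) mod p ^ ?M" using N by (intro nat_padic_mod[OF z] Least_le)
  have "low_digits p r (nat (z N) mod p ^ ?M) = low_digits p r (nat (z N))"
    using M unfolding eq by (rule low_digits_mod_power[OF p])
  then show ?thesis unfolding padic_low_digits_def eq by simp
qed

lemma zeta_coeff_valuation:
  fixes \<pi> :: "'k::{finite,field} fls" and y :: "nat \<Rightarrow> int"
  defines "p \<equiv> CARD('k)"
  defines "z \<equiv> padic_uminus p y"
  assumes p: "normalization_semidom_class.prime p" and \<pi>: "positive_uniformizer \<pi>"
    and y: "y \<in> padic_ints p"
  shows "zeta_coeff \<pi> y i \<noteq> 0 \<longleftrightarrow> padic_digit_count_ge p (i * (p - 1)) z"
    and "zeta_coeff \<pi> y i \<noteq> 0 \<Longrightarrow>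
      fls_subdegree (zeta_coeff \<pi> y i) = int (\<Sum>t=1..i. padic_low_digits p (t * (p - 1)) z)"
proof -
  have p1: "1 < p" using p by (rule prime_gt_1_nat)
  have z: "z \<in> padic_ints p"
    unfolding z_def using padic_uminus_in_padic_ints[OF y] p1 by simp
  have \<pi>0: "\<pi> \<noteq> 0" "fls_subdegree \<pi> = 1" using \<pi> by (auto simp: positive_uniformizer_def)
  note nth = zeta_coeff_nth[OF p[unfolded p_def] \<pi> y[unfolded p_def], folded p_def, folded z_def]
  have zero: "zeta_coeff \<pi> y i = 0" if "\<not> padic_digit_count_ge p (i * (p - 1)) z"
  proof (rule fls_eqI)
    fix l
    \<comment> \<open>Coefficient \<open>l\<close> is visible at stage \<open>nat l\<close>, where
      the truncation has too few powers for the power sum to survive.\<close>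
    have "nat l < p ^ nat l" using p1 by (intro power_gt_expt) simp
    then have "l < int (p ^ nat l)" by linarith
    moreover have "digit_sum p (nat (z (nat l))) < i * (p - 1)"
      using that by (auto simp: padic_digit_count_ge_def not_le)
    ultimately show "fls_nth (zeta_coeff \<pi> y i) l = fls_nth 0 l"
      using nth[of l "nat l" i] power_sum_monics_eq_0[OF p[unfolded p_def], of _ i] by (simp add: p_def)
  qed
  have nonzero: "zeta_coeff \<pi> y i \<noteq> 0 \<and>
      fls_subdegree (zeta_coeff \<pi> y i) = int (\<Sum>t=1..i. padic_low_digits p (t * (p - 1)) z)"
    if D: "padic_digit_count_ge p (i * (p - 1)) z"
  proof -
    define V where "V = (\<Sum>t=1..i. padic_low_digits p (t * (p - 1)) z)"
    obtain N0 where N0: "i * (p - 1) \<le> digit_sum p (nat (z N0))"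
      using D by (auto simp: padic_digit_count_ge_def)
    \<comment> \<open>Late enough to contain the required powers and to make position
      \<open>V\<close>, the claimed valuation, lie below the precision \<open>p ^ N\<close>.\<close>
    define N where "N = max N0 V"
    define m where "m = nat (z N)"
    have ds: "i * (p - 1) \<le> digit_sum p m"
      using N0 padic_digit_sum_mono[OF p z, of N0 N] by (simp add: N_def m_def)
    have V: "V = low_block_sum p i m"
      unfolding V_def low_block_sum_def m_def
    proof (rule sum.cong)
      fix t assume "t \<in> {1..i}"
      then have "t * (p - 1) \<le> digit_sum p (nat (z N))"
        using ds by (metis atLeastAtMost_iff le_trans m_def mult_le_mono1)
      then show "padic_low_digits p (t * (p - 1)) z = low_digits p (t * (p - 1)) (nat (z N))"
        by (rule padic_low_digits_eq[OF p z])
    qed simp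
    define P where "P = \<pi> ^ (i * m) * power_sum (monics i :: 'k poly set) m"
    have P: "P \<noteq> 0" "fls_subdegree P = int V"
      using power_sum_monics_subdegree[OF p[unfolded p_def] ds[unfolded p_def]] \<pi>0 V
      by (simp_all add: P_def fls_subdegree_pow p_def)
    have "V < p ^ V" using p1 by (intro power_gt_expt) simp
    also have "\<dots> \<le> p ^ N" using p1 by (intro power_increasing) (auto simp: N_def)
    finally have VN: "V < p ^ N" .
    have eq: "fls_nth (zeta_coeff \<pi> y i) l = fls_nth P l" if "l < int (p ^ N)" for l
      using nth[OF that] by (simp add: P_def m_def)
    have "fls_nth (zeta_coeff \<pi> y i) (int V) \<noteq> 0"
      using eq[of "int V"] P VN nth_fls_subdegree_nonzero[OF P(1)] by (simp del: nth_fls_subdegree_nonzero)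
    moreover from this have "fls_subdegree (zeta_coeff \<pi> y i) = int V"
    proof (rule fls_subdegree_eqI)
      fix l assume l: "l < int V"
      then have "l < int (p ^ N)" using VN by linarith
      then show "fls_nth (zeta_coeff \<pi> y i) l = 0" using eq[of l] P l by simp
    qed
    ultimately show ?thesis unfolding V_def by auto
  qed
  show "zeta_coeff \<pi> y i \<noteq> 0 \<longleftrightarrow> padic_digit_count_ge p (i * (p - 1)) z"
    using zero nonzero by blast
  then show "zeta_coeff \<pi> y i \<noteq> 0 \<Longrightarrow>
      fls_subdegree (zeta_coeff \<pi> y i) = int (\<Sum>t=1..i. padic_low_digits p (t * (p - 1)) z)"
    using nonzero by blast
qed

lemma padic_low_digits_strict_mono:
  assumes p: "normalization_semidom_class.prime p" and z: "z \<in> padic_ints p"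
    and "r < r'" "padic_digit_count_ge p r' z"
  shows "padic_low_digits p r z < padic_low_digits p r' z"
proof -
  obtain N where N: "r' \<le> digit_sum p (nat (z N))" using assms by (auto simp: padic_digit_count_ge_def)
  then show ?thesis
    using padic_low_digits_eq[OF p z, of r' N] padic_low_digits_eq[OF p z, of r N] assms(3)
      low_digits_strict_mono[OF p assms(3) N] by simp
qed

lemma padic_digit_count_ge_mono:
  "padic_digit_count_ge p r' z \<Longrightarrow> r \<le> r' \<Longrightarrow> padic_digit_count_ge p r z"
  unfolding padic_digit_count_ge_def using le_trans by blast

lemma padic_digit_count_ge_0 [simp]: "padic_digit_count_ge p 0 z"
  by (simp add: padic_digit_count_ge_def)

section \<open>Integers as p-adic integers\<close>

lemma padic_of_int_in_padic_ints: "0 < p \<Longrightarrow> padic_of_int p m \<in> padic_ints p"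
  by (auto simp: padic_of_int_def padic_ints_def mod_mod_cancel)

lemma padic_uminus_padic_of_int_uminus:
  "padic_uminus p (padic_of_int p (- int j)) = padic_of_int p (int j)"
  by (auto simp: padic_uminus_def padic_of_int_def mod_minus_eq)

lemma nat_padic_of_int: "nat (padic_of_int p (int j) N) = j mod p ^ N"
  by (simp add: padic_of_int_def nat_mod_distrib nat_power_eq)

lemma padic_digit_count_ge_of_nat:
  assumes p: "normalization_semidom_class.prime p"
  shows "padic_digit_count_ge p r (padic_of_int p (int j)) \<longleftrightarrow> r \<le> digit_sum p j"
proof
  assume "padic_digit_count_ge p r (padic_of_int p (int j))"
  then obtain N where "r \<le> digit_sum p (j mod p ^ N)"
    by (auto simp: padic_digit_count_ge_def nat_padic_of_int)
  then show "r \<le> digit_sum p j"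
    using digit_sum_submask[OF p submask_mod_power[OF p, of j N]] by simp
next
  assume "r \<le> digit_sum p j"
  moreover have "j < p ^ j" using prime_gt_1_nat[OF p] by (intro power_gt_expt) simp
  ultimately show "padic_digit_count_ge p r (padic_of_int p (int j))"
    by (auto simp: padic_digit_count_ge_def nat_padic_of_int intro!: exI[of _ j])
qed

lemma padic_low_digits_of_nat:
  assumes p: "normalization_semidom_class.prime p" and "r \<le> digit_sum p j"
  shows "padic_low_digits p r (padic_of_int p (int j)) = low_digits p r j"
proof -
  have "j < p ^ j" using prime_gt_1_nat[OF p] by (intro power_gt_expt) simp
  then have "nat (padic_of_int p (int j) j) = j" by (simp add: nat_padic_of_int)
  then show ?thesis
    using padic_low_digits_eq[OF p padic_of_int_in_padic_ints, of r "int j" j] assms prime_gt_0_nat[OF p]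
    by simp
qed

section \<open>Newton polygons with increasing slopes\<close>

text \<open>A line of slope \<open>l\<close> through \<open>q\<close> has all other points strictly
  above it. The open half-plane above it stays convex when \<open>q\<close> is added, so it and
  \<open>q\<close> contain the whole hull, and removing \<open>q\<close> leaves the hull
  convex.\<close>

lemma newton_vertexI:
  fixes S :: "(real \<times> real) set" and l :: real
  assumes q: "q \<in> S" and S: "\<And>s. s \<in> S \<Longrightarrow> s \<noteq> q \<Longrightarrow> snd q - l * fst q < snd s - l * fst s"
  shows "q \<in> newton_vertices S"
proof -
  define H where "H = {s. snd q - l * fst q < snd s - l * fst s}"
  have H: "H = {s. inner (- l, 1) s > snd q - l * fst q}"
    by (auto simp: H_def inner_prod_def)
  have cH: "convex H" unfolding H by (rule convex_halfspace_gt)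
  have "convex (insert q H)"
    unfolding convex_alt
  proof (intro ballI allI impI)
    fix x y :: "real \<times> real" and u :: real
    assume x: "x \<in> insert q H" and y: "y \<in> insert q H" and u: "0 \<le> u \<and> u \<le> 1"
    define f where "f s = snd s - l * fst s" for s :: "real \<times> real"
    have f: "f ((1 - u) *\<^sub>R x + u *\<^sub>R y) = (1 - u) * f x + u * f y"
      by (simp add: f_def algebra_simps)
    have in_H: "s \<in> H \<longleftrightarrow> f q < f s" for s by (simp add: H_def f_def)
    have fx: "f q \<le> f x" and fy: "f q \<le> f y" using x y in_H by auto
    consider "x = q" "y = q" | "u = 0" | "u = 1" | "x \<in> H" "u < 1" | "y \<in> H" "0 < u"
      using x y u by fastforce
    then show "(1 - u) *\<^sub>R x + u *\<^sub>R y \<in> insert q H"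
    proof cases
      case 1
      then show ?thesis by (simp add: algebra_simps)
    next
      case 4
      then have "(1 - u) * f q < (1 - u) * f x" using in_H by simp
      moreover have "u * f q \<le> u * f y" using fy u by (intro mult_left_mono) auto
      ultimately have "(1 - u) * f q + u * f q < (1 - u) * f x + u * f y" by (rule add_less_le_mono)
      then show ?thesis using f in_H by (simp add: algebra_simps)
    next
      case 5
      then have "u * f q < u * f y" using in_H by simp
      moreover have "(1 - u) * f q \<le> (1 - u) * f x" using fx u by (intro mult_left_mono) auto
      ultimately have "(1 - u) * f q + u * f q < (1 - u) * f x + u * f y" by (intro add_le_less_mono)
      then show ?thesis using f in_H by (simp add: algebra_simps)
    qed (use x y in simp_all)
  qed
  then have hull: "convex hull S \<subseteq> insert q H"
    using S by (intro hull_minimal) (auto simp: H_def)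
  have qS: "q \<in> convex hull S" using q by (rule hull_inc)
  have "q \<in> lower_convex_hull S"
    unfolding lower_convex_hull_def
  proof (intro CollectI conjI qS allI impI)
    fix t assume "(fst q, t) \<in> convex hull S"
    then have "(fst q, t) \<in> insert q H" using hull by blast
    then show "snd q \<le> t" by (cases q) (auto simp: H_def)
  qed
  moreover have "convex hull S - {q} = convex hull S \<inter> H"
    using hull by (auto simp: H_def)
  then have "convex (convex hull S - {q})"
    using convex_Int[OF convex_convex_hull cH, of S] by simp
  then have "q extreme_point_of (convex hull S)"
    using qS by (simp add: extreme_point_of_stillconvex)
  ultimately show ?thesis by (simp add: newton_vertices_def)
qed

definition slope_points :: "nat set \<Rightarrow> (nat \<Rightarrow> nat) \<Rightarrow> (real \<times> real) set" where
  "slope_points D s = (\<lambda>i. (real i, real (\<Sum>t=1..i. s t))) ` D"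

text \<open>Together with \<open>slope_sum_ge\<close> this places the points right and left of a
  vertex above a line of slope \<open>l\<close>, given that the slopes in between lie on the proper
  side of \<open>l\<close>.\<close>

lemma slope_sum_le:
  fixes s :: "nat \<Rightarrow> nat" and l :: real
  assumes "i \<le> k" "\<And>t. i < t \<Longrightarrow> t \<le> k \<Longrightarrow> l < real (s t)"
  shows "real (\<Sum>t=1..i. s t) + (real k - real i) * l \<le> real (\<Sum>t=1..k. s t)"
    and "i < k \<Longrightarrow> real (\<Sum>t=1..i. s t) + (real k - real i) * l < real (\<Sum>t=1..k. s t)"
proof -
  have split: "(\<Sum>t=1..k. s t) = (\<Sum>t=1..i. s t) + (\<Sum>t\<in>{i<..k}. s t)"
    using assms(1) by (subst sum.union_disjoint[symmetric]) (auto intro!: sum.cong)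
  have c: "(real k - real i) * l = (\<Sum>t\<in>{i<..k}. l)" using assms(1) by (simp add: of_nat_diff)
  have le: "(\<Sum>t\<in>{i<..k}. l) \<le> (\<Sum>t\<in>{i<..k}. real (s t))"
    by (rule sum_mono) (use assms(2) in force)
  show "real (\<Sum>t=1..i. s t) + (real k - real i) * l \<le> real (\<Sum>t=1..k. s t)"
    unfolding split c using le by simp
  assume "i < k"
  then have "(\<Sum>t\<in>{i<..k}. l) < (\<Sum>t\<in>{i<..k}. real (s t))"
    by (intro sum_strict_mono) (use assms(2) in force)+
  then show "real (\<Sum>t=1..i. s t) + (real k - real i) * l < real (\<Sum>t=1..k. s t)"
    unfolding split c by simp
qed

lemma slope_sum_ge:
  fixes s :: "nat \<Rightarrow> nat" and l :: real
  assumes "k < i" "\<And>t. k < t \<Longrightarrow> t \<le> i \<Longrightarrow> real (s t) < l"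
  shows "real (\<Sum>t=1..i. s t) + (real k - real i) * l < real (\<Sum>t=1..k. s t)"
proof -
  have split: "(\<Sum>t=1..i. s t) = (\<Sum>t=1..k. s t) + (\<Sum>t\<in>{k<..i}. s t)"
    using assms(1) by (subst sum.union_disjoint[symmetric]) (auto intro!: sum.cong)
  have c: "(real i - real k) * l = (\<Sum>t\<in>{k<..i}. l)" using assms(1) by (simp add: of_nat_diff)
  have "(\<Sum>t\<in>{k<..i}. real (s t)) < (\<Sum>t\<in>{k<..i}. l)"
    by (rule sum_strict_mono) (use assms in force)+
  then have "(\<Sum>t\<in>{k<..i}. real (s t)) < (real i - real k) * l" unfolding c .
  then show ?thesis unfolding split by (simp add: algebra_simps)
qed

lemma newton_vertices_slope_points:
  assumes s: "strict_mono s"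
  shows "newton_vertices (slope_points D s) = slope_points D s"
proof
  show "newton_vertices (slope_points D s) \<subseteq> slope_points D s"
    using extreme_point_of_convex_hull by (auto simp: newton_vertices_def)
  show "slope_points D s \<subseteq> newton_vertices (slope_points D s)"
  proof
    fix q assume q: "q \<in> slope_points D s"
    define v where "v i = (\<Sum>t=1..i. s t)" for i
    obtain i where i: "i \<in> D" "q = (real i, real (v i))"
      using q by (auto simp: slope_points_def v_def)
    \<comment> \<open>Slopes are natural numbers, so the half separates \<open>s i\<close> from
      every later slope.\<close>
    define l where "l = real (s i) + 1 / 2"
    show "q \<in> newton_vertices (slope_points D s)"
    proof (rule newton_vertexI[OF q])
      fix r assume "r \<in> slope_points D s" "r \<noteq> q"
      then obtain k where k: "r = (real k, real (v k))" "k \<noteq> i"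
        using i by (auto simp: slope_points_def v_def)
      have "real (v i) + (real k - real i) * l < real (v k)"
      proof (cases "i < k")
        case True
        have "l < real (s t)" if "i < t" for t
          using strict_monoD[OF s that] unfolding l_def by linarith
        then show ?thesis unfolding v_def using True by (intro slope_sum_le) auto
      next
        case False
        have "real (s t) < l" if "t \<le> i" for t
          using strict_mono_mono[OF s] that by (auto dest!: monoD[of s t i] simp: l_def)
        then show ?thesis unfolding v_def using False k(2) by (intro slope_sum_ge) auto
      qed
      then show "snd q - l * fst q < snd r - l * fst r"
        by (simp add: i k algebra_simps)
    qed
  qed
qed

text \<open>Every point is a vertex and \<open>D\<close> is an initial segment, so consecutive
  vertices have consecutive indices and vertex \<open>k\<close> has exactly \<open>k\<close>
  vertices to its left.\<close>

lemma newton_segment_at_slope_points: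
  assumes s: "strict_mono s" and D: "\<forall>i\<in>D. \<forall>k\<le>i. k \<in> D"
  shows "newton_segment_at (slope_points D s) k L \<longleftrightarrow>
    1 \<le> k \<and> k \<in> D \<and> L = closed_segment (real (k - 1), real (\<Sum>t=1..k - 1. s t))
      (real k, real (\<Sum>t=1..k. s t))"
proof -
  define P where "P i = (real i, real (\<Sum>t=1..i. s t))" for i
  have S: "slope_points D s = P ` D" by (simp add: slope_points_def P_def)
  have fstP [simp]: "fst (P i) = real i" for i by (simp add: P_def)
  have inj: "inj_on P A" for A by (auto simp: inj_on_def P_def)
  have below: "{q \<in> P ` D. fst q < real k} = P ` {..<k}" if "k \<in> D" for k
    using D that by auto
  have card: "card (P ` {..<k}) = k" for k by (simp add: card_image inj)
  show ?thesis
    unfolding newton_segment_at_def newton_vertices_slope_points[OF s] unfolding S P_def[symmetric]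
  proof
    assume "\<exists>q\<in>P ` D. \<exists>r\<in>P ` D. fst q < fst r \<and>
        \<not> (\<exists>s\<in>P ` D. fst q < fst s \<and> fst s < fst r) \<and>
        finite {s \<in> P ` D. fst s < fst r} \<and>
        k = card {s \<in> P ` D. fst s < fst r} \<and> L = closed_segment q r"
    then obtain q r where q: "q \<in> P ` D" and r: "r \<in> P ` D" and lt: "fst q < fst r"
      and none: "\<not> (\<exists>s\<in>P ` D. fst q < fst s \<and> fst s < fst r)"
      and k: "k = card {s \<in> P ` D. fst s < fst r}" and L: "L = closed_segment q r"
      by blast
    obtain a b where [simp]: "q = P a" "r = P b" and ab: "a \<in> D" "b \<in> D" using q r by auto
    have "a < b" using lt by simp
    moreover have "\<not> (a < b - 1)"
    proof
      assume *: "a < b - 1"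
      have "b - 1 \<in> D" using D ab(2) by auto
      then show False using none * by (auto dest!: bspec[of _ _ "P (b - 1)"])
    qed
    ultimately have "a = b - 1" "1 \<le> b" by auto
    moreover have "k = b" using k below[OF ab(2)] card by simp
    ultimately show "1 \<le> k \<and> k \<in> D \<and> L = closed_segment (P (k - 1)) (P k)" using ab L by simp
  next
    assume *: "1 \<le> k \<and> k \<in> D \<and> L = closed_segment (P (k - 1)) (P k)"
    then have kD: "k \<in> D" "k - 1 \<in> D" using D by auto
    have "{s \<in> P ` D. fst s < fst (P k)} = P ` {..<k}" using below[OF kD(1)] by simp
    then have "finite {s \<in> P ` D. fst s < fst (P k)}" "k = card {s \<in> P ` D. fst s < fst (P k)}"
      using card by simp_all
    moreover have "\<not> (\<exists>s\<in>P ` D. fst (P (k - 1)) < fst s \<and> fst s < fst (P k))" by auto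
    ultimately show "\<exists>q\<in>P ` D. \<exists>r\<in>P ` D. fst q < fst r \<and>
        \<not> (\<exists>s\<in>P ` D. fst q < fst s \<and> fst s < fst r) \<and>
        finite {s \<in> P ` D. fst s < fst r} \<and>
        k = card {s \<in> P ` D. fst s < fst r} \<and> L = closed_segment q r"
      using * kD by (intro bexI[of _ "P (k - 1)"] bexI[of _ "P k"]) auto
  qed
qed

lemma has_finite_slopes_slope_points:
  assumes s: "strict_mono s" and D: "\<forall>i\<in>D. \<forall>k\<le>i. k \<in> D" and n: "n \<in> D"
  shows "has_finite_slopes (slope_points D s) n"
  unfolding has_finite_slopes_def
proof
  fix k assume "k \<in> {1..n}"
  then have "1 \<le> k" "k \<in> D" using D n by auto
  then have "newton_segment_at (slope_points D s) k (closed_segment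
      (real (k - 1), real (\<Sum>t=1..k - 1. s t)) (real k, real (\<Sum>t=1..k. s t)))"
    unfolding newton_segment_at_slope_points[OF s D] by blast
  then show "\<exists>L. newton_segment_at (slope_points D s) k L" ..
qed

lemma slope_points_same_first_segments:
  assumes s: "strict_mono s" "strict_mono s'"
    and D: "\<forall>i\<in>D. \<forall>k\<le>i. k \<in> D" "\<forall>i\<in>D'. \<forall>k\<le>i. k \<in> D'"
    and n: "n \<in> D" "n \<in> D'" and eq: "\<And>t. 1 \<le> t \<Longrightarrow> t \<le> n \<Longrightarrow> s t = s' t"
  shows "same_first_segments (slope_points D s) (slope_points D' s') n"
proof -
  have mem: "k \<in> D" "k \<in> D'" if "k \<in> {1..n}" for k using D n that by auto
  have sums: "(\<Sum>t=1..k. s t) = (\<Sum>t=1..k. s' t)" if "k \<le> n" for k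
    using eq that by (intro sum.cong) auto
  show "same_first_segments (slope_points D s) (slope_points D' s') n"
    unfolding same_first_segments_def newton_segment_at_slope_points[OF s(1) D(1)]
      newton_segment_at_slope_points[OF s(2) D(2)]
  proof (intro ballI allI)
    fix k L assume k: "k \<in> {1..n}"
    then have "(\<Sum>t=1..k. s t) = (\<Sum>t=1..k. s' t)" "(\<Sum>t=1..k - 1. s t) = (\<Sum>t=1..k - 1. s' t)"
      by (intro sums; force)+
    then show "(1 \<le> k \<and> k \<in> D \<and> L = closed_segment (real (k - 1), real (\<Sum>t=1..k - 1. s t))
        (real k, real (\<Sum>t=1..k. s t))) \<longleftrightarrow> (1 \<le> k \<and> k \<in> D' \<and>
        L = closed_segment (real (k - 1), real (\<Sum>t=1..k - 1. s' t)) (real k, real (\<Sum>t=1..k. s' t)))"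
      using mem[OF k] by simp
  qed
qed

section \<open>Zeros of power series over a complete ultrametric field\<close>

text \<open>The sorts of \<open>'c\<close> provide a field and a complete metric without linking
  them; these assumptions are the link.\<close>

locale ultrametric_field =
  fixes nrm :: "'c::{field,complete_space} \<Rightarrow> real"
  assumes dist_eq: "dist x y = nrm (x - y)"
    and nrm_mult: "nrm (x * y) = nrm x * nrm y"
    and nrm_add: "nrm (x + y) \<le> max (nrm x) (nrm y)"
begin

lemma nrm_eq_dist: "nrm x = dist x 0"
  by (simp add: dist_eq)

lemma nrm_0 [simp]: "nrm 0 = 0"
  by (simp add: nrm_eq_dist)

lemma nrm_nonneg [simp]: "0 \<le> nrm x"
  by (simp add: nrm_eq_dist)

lemma nrm_eq_0_iff [simp]: "nrm x = 0 \<longleftrightarrow> x = 0"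
  by (simp add: nrm_eq_dist)

lemma nrm_pos_iff [simp]: "0 < nrm x \<longleftrightarrow> x \<noteq> 0"
  by (simp add: nrm_eq_dist)

lemma nrm_minus_commute: "nrm (x - y) = nrm (y - x)"
  by (simp flip: dist_eq add: dist_commute)

lemma nrm_minus [simp]: "nrm (- x) = nrm x"
  using nrm_minus_commute[of 0 x] by simp

lemma nrm_1 [simp]: "nrm 1 = 1"
  using nrm_mult[of 1 1] nrm_eq_0_iff[of 1] by simp

lemma nrm_power: "nrm (x ^ n) = nrm x ^ n"
  by (induction n) (simp_all add: nrm_mult)

lemma nrm_divide: "nrm (x / y) = nrm x / nrm y"
proof (cases "y = 0")
  case False
  then have "nrm (x / y) * nrm y = nrm x" by (simp flip: nrm_mult)
  then show ?thesis using False by (simp add: field_simps)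
qed simp

lemma nrm_sum_le:
  assumes "\<And>i. i \<in> A \<Longrightarrow> nrm (f i) \<le> B" "0 \<le> B"
  shows "nrm (sum f A) \<le> B"
  using assms
proof (induction A rule: infinite_finite_induct)
  case (insert a A)
  then show ?case using nrm_add[of "f a" "sum f A"] by fastforce
qed auto

lemma nrm_sum_less:
  assumes "finite A" "\<And>i. i \<in> A \<Longrightarrow> nrm (f i) < B" "0 < B"
  shows "nrm (sum f A) < B"
  using assms
proof (induction A rule: finite_induct)
  case (insert a A)
  then show ?case using nrm_add[of "f a" "sum f A"] by fastforce
qed auto

lemma nrm_add_eq:
  assumes "nrm y < nrm x"
  shows "nrm (x + y) = nrm x"
  using assms nrm_add[of x y] nrm_add[of "x + y" "- y"] by auto

lemma tendsto_nrm: "f \<longlonglongrightarrow> l \<Longrightarrow> (\<lambda>n. nrm (f n)) \<longlonglongrightarrow> nrm l"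
  unfolding nrm_eq_dist by (intro tendsto_dist tendsto_const)

text \<open>Continuity of the field operations is not part of the sorts, so it is obtained from the
  scaling of distances.\<close>

lemma tendsto_affine:
  fixes f :: "nat \<Rightarrow> 'c" and a c :: 'c
  assumes "f \<longlonglongrightarrow> l"
  shows "(\<lambda>n. a - c * f n) \<longlonglongrightarrow> a - c * l"
proof -
  have "dist (a - c * f n) (a - c * l) = nrm c * dist (f n) l" for n
  proof -
    have "a - c * f n - (a - c * l) = c * (l - f n)" by (simp add: algebra_simps)
    then show ?thesis by (simp add: dist_eq nrm_mult nrm_minus_commute)
  qed
  moreover have "(\<lambda>n. nrm c * dist (f n) l) \<longlonglongrightarrow> nrm c * 0"
    using assms by (intro tendsto_mult tendsto_const) (simp add: tendsto_dist_iff[of f])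
  ultimately show ?thesis unfolding tendsto_dist_iff[of "\<lambda>n. a - c * f n"] by simp
qed

text \<open>In an ultrametric field a block of the series is bounded by its largest term, so small
  terms already give a Cauchy sequence.\<close>

lemma summable_if_nrm_tendsto_0:
  assumes "(\<lambda>n. nrm (t n)) \<longlonglongrightarrow> 0"
  shows "summable t"
proof -
  have "Cauchy (\<lambda>n. sum t {..<n})"
  proof (rule metric_CauchyI)
    fix e :: real assume e: "0 < e"
    obtain N where N: "\<And>n. N \<le> n \<Longrightarrow> nrm (t n) < e"
      using order_tendstoD(2)[OF assms e] by (auto simp: eventually_sequentially)
    have "dist (sum t {..<m}) (sum t {..<n}) < e" if "N \<le> m" "m \<le> n" for m n
    proof -
      have "sum t {..<n} - sum t {..<m} = sum t {m..<n}"
        using that by (simp add: sum_diff_nat_ivl lessThan_atLeast0)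
      moreover have "nrm (sum t {m..<n}) < e"
        by (rule nrm_sum_less) (use N that e in auto)
      ultimately show ?thesis by (simp add: dist_eq nrm_minus_commute[of "sum t {..<m}"])
    qed
    then show "\<exists>M. \<forall>m\<ge>M. \<forall>n\<ge>M. dist (sum t {..<m}) (sum t {..<n}) < e"
      by (metis dist_commute nle_le)
  qed
  then show ?thesis by (simp add: Cauchy_convergent summable_iff_convergent)
qed

lemma nrm_sums_dominant:
  assumes "t sums S" and dom: "\<And>k. k \<noteq> i \<Longrightarrow> nrm (t k) < nrm (t i)"
  shows "nrm S = nrm (t i)"
proof -
  have pos: "0 < nrm (t i)" using dom[of "Suc i"] nrm_nonneg[of "t (Suc i)"] by linarith
  have "nrm (sum t {..<n}) = nrm (t i)" if "i < n" for n
  proof -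
    have "sum t {..<n} = t i + sum t ({..<n} - {i})" using that by (intro sum.remove) auto
    moreover have "nrm (sum t ({..<n} - {i})) < nrm (t i)"
      by (rule nrm_sum_less) (use dom pos in auto)
    ultimately show ?thesis by (simp add: nrm_add_eq)
  qed
  then have "eventually (\<lambda>n. nrm (sum t {..<n}) = nrm (t i)) sequentially"
    by (rule eventually_mono[OF eventually_gt_at_top[of i]])
  then have "(\<lambda>n. nrm (sum t {..<n})) \<longlonglongrightarrow> nrm (t i)" by (rule tendsto_eventually)
  moreover have "(\<lambda>n. nrm (sum t {..<n})) \<longlonglongrightarrow> nrm S"
    using assms(1) unfolding sums_def by (rule tendsto_nrm)
  ultimately show ?thesis by (rule LIMSEQ_unique[rotated])
qed

text \<open>The quotient \<open>r ^ k / r\<close> stands for the exponent \<open>k - 1\<close> and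
  remains usable for \<open>k = 0\<close>.\<close>

lemma nrm_power_diff_le:
  assumes "nrm x = r" "nrm w = r" "0 < r"
  shows "nrm (x ^ k - w ^ k) \<le> nrm (x - w) * (r ^ k / r)"
proof (induction k)
  case (Suc k)
  have eq: "x ^ Suc k - w ^ Suc k = x * (x ^ k - w ^ k) + (x - w) * w ^ k"
    by (simp add: algebra_simps)
  have "nrm (x * (x ^ k - w ^ k)) \<le> nrm (x - w) * (r ^ Suc k / r)"
    using mult_left_mono[OF Suc, of r] assms unfolding nrm_mult by (simp add: field_simps)
  moreover have "nrm ((x - w) * w ^ k) = nrm (x - w) * (r ^ Suc k / r)"
    using assms by (simp add: nrm_mult nrm_power)
  ultimately show ?case unfolding eq using nrm_add[of "x * (x ^ k - w ^ k)" "(x - w) * w ^ k"] by simp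
qed (use assms in simp)

lemma nrm_power_quotient_diff_le:
  assumes x: "nrm x = r" and w: "nrm w = r" and r: "0 < r"
  shows "nrm (x ^ k / x ^ j - w ^ k / w ^ j) \<le> nrm (x - w) * (r ^ k / r / r ^ j)"
proof -
  have nz: "x \<noteq> 0" "w \<noteq> 0" using assms by auto
  have eq: "x ^ k / x ^ j - w ^ k / w ^ j
      = (x ^ k - w ^ k) / x ^ j + w ^ k * (w ^ j - x ^ j) / (x ^ j * w ^ j)"
    using nz by (simp add: field_simps)
  have "nrm ((x ^ k - w ^ k) / x ^ j) \<le> nrm (x - w) * (r ^ k / r) / r ^ j"
    unfolding nrm_divide nrm_power x
    by (rule divide_right_mono[OF nrm_power_diff_le[OF assms]]) (use r in simp)
  moreover have "nrm (w ^ k * (w ^ j - x ^ j) / (x ^ j * w ^ j)) \<le> nrm (x - w) * (r ^ k / r) / r ^ j"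
  proof -
    have "nrm (w ^ k * (w ^ j - x ^ j) / (x ^ j * w ^ j)) = nrm (x ^ j - w ^ j) * (r ^ k / (r ^ j * r ^ j))"
      by (simp add: nrm_divide nrm_mult nrm_power x w nrm_minus_commute[of "w ^ j"])
    also have "\<dots> \<le> nrm (x - w) * (r ^ j / r) * (r ^ k / (r ^ j * r ^ j))"
      by (intro mult_right_mono nrm_power_diff_le assms) (use r in simp)
    also have "\<dots> = nrm (x - w) * (r ^ k / r) / r ^ j" using r by (simp add: field_simps)
    finally show ?thesis .
  qed
  ultimately show ?thesis
    unfolding eq by (intro order_trans[OF nrm_add] max.boundedI) simp_all
qed

end

text \<open>Outside \<open>D\<close> the coefficients vanish and the values of \<open>s\<close> are
  arbitrary. Demanding monotonicity there as well lets finite and infinite \<open>D\<close> be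
  treated alike.\<close>

locale newton_series = ultrametric_field nrm
  for nrm :: "'c::{field,complete_space} \<Rightarrow> real" +
  fixes q :: real and b :: "nat \<Rightarrow> 'c" and D :: "nat set" and s :: "nat \<Rightarrow> nat"
  assumes q: "1 < q" and s: "strict_mono s"
    and D0: "0 \<in> D" and D: "i \<in> D \<Longrightarrow> k \<le> i \<Longrightarrow> k \<in> D"
    and nrm_b: "nrm (b i) = (if i \<in> D then q powr - real (\<Sum>t=1..i. s t) else 0)"
begin

definition v :: "nat \<Rightarrow> nat" where "v i = (\<Sum>t=1..i. s t)"

definition series :: "'c \<Rightarrow> 'c" where "series x = (\<Sum>i. b i * x ^ i)"

lemma b_eq_0_iff: "b i = 0 \<longleftrightarrow> i \<notin> D"
  using nrm_b[of i] q nrm_eq_0_iff[of "b i"] by (auto split: if_splits)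

lemma nrm_term:
  assumes "nrm x = q powr l"
  shows "nrm (b i * x ^ i) = (if i \<in> D then q powr (real i * l - real (v i)) else 0)"
proof -
  have "(q powr l) ^ i = q powr (real i * l)"
    using q by (simp add: powr_powr powr_realpow[symmetric] mult.commute)
  then show ?thesis
    using assms by (simp add: nrm_mult nrm_power nrm_b v_def powr_add[symmetric])
qed

lemma nrm_term_tendsto_0:
  assumes x: "nrm x = q powr l"
  shows "(\<lambda>i. nrm (b i * x ^ i)) \<longlonglongrightarrow> 0"
proof -
  \<comment> \<open>Since \<open>s t\<close> is at least \<open>t\<close>, all slopes beyond
    \<open>K\<close> exceed \<open>l + 1\<close>, and from there the terms are bounded by a
    geometric sequence of ratio \<open>1 / q\<close>.\<close>
  obtain K :: nat where K: "l + 1 < real K" using reals_Archimedean2 by blast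
  define a where "a = real K * (l + 1) - real (v K)"
  define A where "A = q powr a"
  have "nrm (b i * x ^ i) \<le> A * inverse q ^ i" if i: "K \<le> i" for i
  proof (cases "i \<in> D")
    case True
    have "l + 1 < real (s t)" if "K < t" for t
      using K that strict_mono_imp_increasing[OF s, of t] by linarith
    then have "real (v K) + (real i - real K) * (l + 1) \<le> real (v i)"
      unfolding v_def using i by (intro slope_sum_le) auto
    then have "real i * l - real (v i) \<le> a - real i"
      by (simp add: a_def algebra_simps)
    then have "q powr (real i * l - real (v i)) \<le> q powr (a - real i)"
      using q by (intro powr_mono) auto
    also have "\<dots> = A * inverse q ^ i"
      using q by (simp add: A_def powr_diff powr_realpow power_inverse divide_inverse)
    finally show ?thesis using True by (simp add: nrm_term[OF x])
  next
    case False
    then show ?thesis using q by (simp add: nrm_term[OF x] A_def)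
  qed
  then have "eventually (\<lambda>i. norm (nrm (b i * x ^ i)) \<le> A * inverse q ^ i) sequentially"
    by (auto simp: eventually_sequentially)
  moreover have "(\<lambda>i. A * inverse q ^ i) \<longlonglongrightarrow> 0"
    using q by (intro tendsto_mult_right_zero LIMSEQ_realpow_zero) (auto simp: field_simps)
  ultimately show ?thesis by (rule Lim_null_comparison)
qed

lemma nrm_powrE:
  assumes "x \<noteq> 0"
  obtains l where "nrm x = q powr l"
  by (rule that[of "log q (nrm x)"]) (use assms q in \<open>simp add: powr_log_cancel\<close>)

lemma series_sums:
  assumes "x \<noteq> 0"
  shows "(\<lambda>i. b i * x ^ i) sums series x"
proof -
  obtain l where "nrm x = q powr l" using nrm_powrE[OF assms] .
  from nrm_term_tendsto_0[OF this] show ?thesis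
    unfolding series_def by (intro summable_sums summable_if_nrm_tendsto_0)
qed

text \<open>If \<open>l\<close> is no slope, the term at the last index whose slope is below
  \<open>l\<close> strictly dominates all others, so the series cannot vanish.\<close>

lemma series_zero_slope:
  assumes x: "nrm x = q powr l" and zero: "series x = 0"
  shows "\<exists>i\<in>D. 1 \<le> i \<and> l = real (s i)"
proof (rule ccontr)
  assume no: "\<not> ?thesis"
  define I where "I = {i \<in> D. i = 0 \<or> real (s i) \<le> l}"
  have "I \<subseteq> {.. nat \<lfloor>l\<rfloor>}"
  proof
    fix i assume "i \<in> I"
    then have "i = 0 \<or> real i \<le> l"
      using strict_mono_imp_increasing[OF s, of i] by (auto simp: I_def)
    then show "i \<in> {.. nat \<lfloor>l\<rfloor>}" by (auto simp: le_nat_floor)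
  qed
  then have fin: "finite I" by (rule finite_subset) simp
  have "0 \<in> I" using D0 by (simp add: I_def)
  define i where "i = Max I"
  have iI: "i \<in> I" unfolding i_def using fin \<open>0 \<in> I\<close> by (intro Max_in) auto
  have iD: "i \<in> D" using iI by (simp add: I_def)
  have lt: "real (s t) < l" if "1 \<le> t" "t \<le> i" for t
  proof -
    have "s t \<le> s i" using strict_mono_mono[OF s] that by (auto dest: monoD)
    moreover have "real (s i) < l" using iI no that by (force simp: I_def)
    ultimately show ?thesis by linarith
  qed
  have gt: "l < real (s t)" if "i < t" "t \<in> D" for t
  proof -
    have "t \<notin> I" using that Max_ge[OF fin, of t] by (auto simp: i_def)
    then show ?thesis using that by (auto simp: I_def)
  qed
  have "nrm (b k * x ^ k) < nrm (b i * x ^ i)" if "k \<noteq> i" for k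
  proof (cases "k \<in> D")
    case True
    have "real (v i) + (real k - real i) * l < real (v k)"
    proof (cases "i < k")
      case True
      show ?thesis unfolding v_def
        by (rule slope_sum_le(2)) (use True gt D[OF \<open>k \<in> D\<close>] in auto)
    next
      case False
      show ?thesis unfolding v_def
        by (rule slope_sum_ge) (use False that lt in auto)
    qed
    then have "q powr (real k * l - real (v k)) < q powr (real i * l - real (v i))"
      using q by (intro powr_less_mono) (auto simp: algebra_simps)
    then show ?thesis using True iD by (simp add: nrm_term[OF x])
  next
    case False
    then show ?thesis using iD q by (simp add: nrm_term[OF x])
  qed
  moreover have "x \<noteq> 0" using x q by auto
  ultimately have "nrm (series x) = nrm (b i * x ^ i)"
    by (intro nrm_sums_dominant[OF series_sums])
  then show False using zero iD q by (simp add: nrm_term[OF x])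
qed

text \<open>Apart from the two ends of the \<open>i\<close>-th segment, all points lie strictly
  above its line. Integrality turns this into a gap of 1, the source of the factor
  \<open>inverse q\<close> in the contraction.\<close>

lemma slope_gap:
  assumes "k \<noteq> i" "Suc k \<noteq> i" "1 \<le> i"
  shows "real k * real (s i) - real (v k) \<le> real i * real (s i) - real (v i) - 1"
proof -
  have "real (v i) + (real k - real i) * real (s i) < real (v k)"
  proof (cases "i < k")
    case True
    show ?thesis unfolding v_def
      by (rule slope_sum_le(2)) (use True strict_monoD[OF s] in auto)
  next
    case False
    obtain j where j: "i = Suc j" using assms(3) by (cases i) auto
    then have "k < j" using False assms by simp
    then have "real (v j) + (real k - real j) * real (s i) < real (v k)"
      unfolding v_def by (rule slope_sum_ge) (use strict_monoD[OF s] j in auto)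
    then show ?thesis using j by (simp add: v_def algebra_simps)
  qed
  then have "real_of_int (int (v i) + (int k - int i) * int (s i)) < real_of_int (int (v k))" by simp
  then have "int (v i) + (int k - int i) * int (s i) + 1 \<le> int (v k)" by linarith
  then have "real_of_int (int (v i) + (int k - int i) * int (s i) + 1) \<le> real_of_int (int (v k))"
    by (rule of_int_le_iff[THEN iffD2])
  then show ?thesis by (simp add: algebra_simps)
qed

text \<open>
  On the sphere of the \<open>i\<close>-th slope the terms \<open>i - 1\<close> and \<open>i\<close> have equal size and dominate, so
  \<open>x \<mapsto> x - series x / (b i * x ^ (i - 1))\<close> is a contraction whose fixed points are the zeros.
\<close>

lemma ex1_zero_of_slope:
  assumes i: "i \<in> D" "1 \<le> i"
  shows "\<exists>!x. nrm x = q powr real (s i) \<and> series x = 0"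
proof -
  define r where "r = q powr real (s i)"
  obtain j where j: "i = Suc j" using i(2) by (cases i) auto
  have jD: "j \<in> D" using D[OF i(1), of j] j by simp
  have r: "0 < r" using q by (simp add: r_def)
  have b0: "b i \<noteq> 0" "b j \<noteq> 0" using i jD by (simp_all add: b_eq_0_iff)
  have bj: "nrm (b j / b i) = r"
    using i(1) jD q by (simp add: nrm_divide nrm_b r_def j powr_diff[symmetric])
  have small: "nrm (b k / b i) * (r ^ k / r ^ j) \<le> inverse q * r" if "k \<noteq> i" "k \<noteq> j" for k
  proof (cases "k \<in> D")
    case True
    have rp: "r ^ n = q powr (real n * real (s i))" for n
      using q by (simp add: r_def powr_powr powr_realpow[symmetric] mult.commute)
    have nb: "nrm (b n) = q powr - real (v n)" if "n \<in> D" for n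
      using that by (simp only: nrm_b v_def if_True)
    have "nrm (b k / b i) * (r ^ k / r ^ j)
        = q powr ((real k * real (s i) - real (v k)) - (real j * real (s i) - real (v i)))"
      using nb[OF True] nb[OF i(1)]
      by (simp add: rp nrm_divide powr_diff[symmetric] powr_add[symmetric] algebra_simps)
    also have "\<dots> \<le> q powr (real (s i) - 1)"
      using slope_gap[of k i] that i j q by (intro powr_mono) (auto simp: algebra_simps)
    also have "\<dots> = inverse q * r" using q by (simp add: powr_diff r_def field_simps)
    finally show ?thesis .
  next
    case False
    then show ?thesis using q r by (simp add: nrm_divide nrm_b)
  qed
  define f where "f x = x - inverse (b i * x ^ j) * series x" for x
  \<comment> \<open>\<open>g n\<close> is \<open>f\<close> with the series truncated: term
    \<open>i\<close> cancels \<open>x\<close> and term \<open>j\<close> gives a constant of norm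
    \<open>r\<close>. The bounds are proved for these finite sums and then passed to the
    limit.\<close>
  define R where "R n = {..<n} - {i, j}" for n
  define g where "g n x = - (b j / b i) - (\<Sum>k\<in>R n. b k / b i * (x ^ k / x ^ j))" for n x
  have g_eq: "x - inverse (b i * x ^ j) * (\<Sum>k<n. b k * x ^ k) = g n x"
    if "x \<noteq> 0" "i < n" for x n
  proof -
    have "(\<Sum>k<n. b k * x ^ k) = b i * x ^ i + (b j * x ^ j + (\<Sum>k\<in>R n. b k * x ^ k))"
    proof -
      have "(\<Sum>k<n. b k * x ^ k) = b i * x ^ i + (\<Sum>k\<in>{..<n} - {i}. b k * x ^ k)"
        using that by (intro sum.remove) auto
      also have "(\<Sum>k\<in>{..<n} - {i}. b k * x ^ k)
          = b j * x ^ j + (\<Sum>k\<in>{..<n} - {i} - {j}. b k * x ^ k)"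
        using that j by (intro sum.remove) auto
      also have "{..<n} - {i} - {j} = R n" by (auto simp: R_def)
      finally show ?thesis .
    qed
    moreover have "inverse (b i * x ^ j) * (b i * x ^ i) = x"
      using that b0 j by (simp add: field_simps)
    moreover have "inverse (b i * x ^ j) * (b j * x ^ j) = b j / b i"
      using that b0 by (simp add: field_simps)
    moreover have "inverse (b i * x ^ j) * (\<Sum>k\<in>R n. b k * x ^ k)
        = (\<Sum>k\<in>R n. b k / b i * (x ^ k / x ^ j))"
      unfolding sum_distrib_left by (rule sum.cong) (auto simp: field_simps)
    ultimately show ?thesis by (simp only: g_def distrib_left) simp
  qed
  have g_lim: "(\<lambda>n. g n x) \<longlonglongrightarrow> f x" if "nrm x = r" for x
  proof -
    have x: "x \<noteq> 0" using that r by auto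
    have "(\<lambda>n. x - inverse (b i * x ^ j) * (\<Sum>k<n. b k * x ^ k)) \<longlonglongrightarrow> f x"
      unfolding f_def using series_sums[OF x] unfolding sums_def by (rule tendsto_affine)
    moreover have "eventually (\<lambda>n. x - inverse (b i * x ^ j) * (\<Sum>k<n. b k * x ^ k) = g n x) sequentially"
      using eventually_gt_at_top[of i] by eventually_elim (rule g_eq[OF x])
    ultimately show ?thesis by (rule Lim_transform_eventually)
  qed
  have qr: "inverse q * r < r" using q r by (simp add: field_simps)
  have g_nrm: "nrm (g n x) = r" if "nrm x = r" for n x
  proof -
    have "nrm (- (\<Sum>k\<in>R n. b k / b i * (x ^ k / x ^ j))) \<le> inverse q * r"
      unfolding nrm_minus
    proof (rule nrm_sum_le)
      fix k assume "k \<in> R n"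
      then show "nrm (b k / b i * (x ^ k / x ^ j)) \<le> inverse q * r"
        unfolding nrm_mult[of "b k / b i"] nrm_divide[of "x ^ k"] nrm_power that
        by (intro small) (auto simp: R_def)
    qed (use q r in simp)
    then have "nrm (- (b j / b i) + - (\<Sum>k\<in>R n. b k / b i * (x ^ k / x ^ j))) = nrm (- (b j / b i))"
      by (intro nrm_add_eq) (use qr bj in simp)
    then show ?thesis using bj by (simp add: g_def)
  qed
  have g_contr: "dist (g n x) (g n w) \<le> inverse q * dist x w" if x: "nrm x = r" and w: "nrm w = r" for n x w
  proof -
    have "g n w - g n x = (\<Sum>k\<in>R n. b k / b i * (x ^ k / x ^ j - w ^ k / w ^ j))"
      by (simp add: g_def sum_subtractf right_diff_distrib)
    also have "nrm \<dots> \<le> inverse q * nrm (x - w)"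
    proof (rule nrm_sum_le)
      fix k assume k: "k \<in> R n"
      have "nrm (b k / b i * (x ^ k / x ^ j - w ^ k / w ^ j))
          \<le> nrm (b k / b i) * (nrm (x - w) * (r ^ k / r / r ^ j))"
        unfolding nrm_mult[of "b k / b i"]
        by (intro mult_left_mono nrm_power_quotient_diff_le x w r) simp
      also have "\<dots> = nrm (x - w) / r * (nrm (b k / b i) * (r ^ k / r ^ j))"
        by (simp add: field_simps)
      also have "\<dots> \<le> nrm (x - w) / r * (inverse q * r)"
        using small[of k] k r by (intro mult_left_mono) (auto simp: R_def)
      also have "\<dots> = inverse q * nrm (x - w)" using r by simp
      finally show "nrm (b k / b i * (x ^ k / x ^ j - w ^ k / w ^ j)) \<le> inverse q * nrm (x - w)" .
    qed (use q in simp)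
    finally show ?thesis by (simp add: dist_eq nrm_minus_commute[of "g n x"])
  qed
  define A where "A = {x. nrm x = r}"
  have "\<exists>!x\<in>A. f x = x"
  proof (rule Banach_fix[of _ "inverse q"])
    \<comment> \<open>The sphere is closed, hence complete, and it contains
      \<open>b j / b i\<close>.\<close>
    have "A = cball 0 r - ball 0 r" by (auto simp: A_def nrm_eq_dist dist_commute)
    then show "complete A" by (simp add: complete_eq_closed closed_Diff)
    show "A \<noteq> {}" using bj by (auto simp: A_def)
    show "0 \<le> inverse q" "inverse q < 1" using q by (simp_all add: field_simps)
    show "f ` A \<subseteq> A"
    proof
      fix w assume "w \<in> f ` A"
      then obtain x where x: "nrm x = r" "w = f x" by (auto simp: A_def)
      have "(\<lambda>n. nrm (g n x)) \<longlonglongrightarrow> nrm (f x)" by (intro tendsto_nrm g_lim x)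
      then have "(\<lambda>n. r) \<longlonglongrightarrow> nrm (f x)" by (simp only: g_nrm[OF x(1)])
      then show "w \<in> A" using x by (simp add: A_def LIMSEQ_const_iff)
    qed
    show "dist (f x) (f w) \<le> inverse q * dist x w" if "x \<in> A" "w \<in> A" for x w
    proof (rule LIMSEQ_le_const2)
      show "(\<lambda>n. dist (g n x) (g n w)) \<longlonglongrightarrow> dist (f x) (f w)"
        using that by (intro tendsto_dist g_lim) (auto simp: A_def)
      show "\<exists>N. \<forall>n\<ge>N. dist (g n x) (g n w) \<le> inverse q * dist x w"
        using that g_contr by (auto simp: A_def)
    qed
  qed
  moreover have "f x = x \<longleftrightarrow> series x = 0" if "nrm x = r" for x
    using that r b0 by (auto simp: f_def)
  ultimately show ?thesis unfolding A_def r_def[symmetric] by auto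
qed

end

section \<open>Zeros of the zeta function\<close>

lemma strict_mono_extend:
  fixes f :: "nat \<Rightarrow> nat"
  assumes D: "\<forall>i\<in>D. \<forall>k\<le>i. k \<in> D" and f: "\<And>i k. k \<in> D \<Longrightarrow> i < k \<Longrightarrow> f i < f k"
  obtains s where "strict_mono s" "\<And>i. i \<in> D \<Longrightarrow> s i = f i"
proof (cases "D = UNIV")
  case True
  then show ?thesis using that[of f] f by (auto simp: strict_mono_def)
next
  case False
  then obtain M where "M \<notin> D" by blast
  then have "D \<subseteq> {..<M}" using D by (force simp: not_less[symmetric])
  then have fin: "finite D" by (rule finite_subset) simp
  \<comment> \<open>Beyond the finite set \<open>D\<close> the values start above the sum of all
    values on \<open>D\<close>.\<close>
  define s where "s i = (if i \<in> D then f i else sum f D + i + 1)" for i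
  have "s i < s k" if "i < k" for i k
  proof (cases "k \<in> D")
    case True
    then have "i \<in> D" using D \<open>i < k\<close> by auto
    then show ?thesis using True f[OF True \<open>i < k\<close>] by (simp add: s_def)
  next
    case False
    have "f i \<le> sum f D" if "i \<in> D" using fin that by (intro member_le_sum) auto
    then show ?thesis using False \<open>i < k\<close> by (auto simp: s_def)
  qed
  then show ?thesis by (intro that[of s]) (auto simp: strict_mono_def s_def)
qed

lemma is_C_infinity_nrm:
  fixes emb :: "'k::{finite,field} fls alg_closure \<Rightarrow> 'c::{field,complete_space}"
  assumes "is_C_infinity emb \<nu>" "x \<noteq> 0"
  shows "dist x 0 = real CARD('k) powr - \<nu> x"
  using assms unfolding is_C_infinity_def by (metis diff_zero)

text \<open>The norm is taken as the distance to 0, which is right at 0 too, where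
  \<open>\<nu>\<close> is unconstrained; hence the separate zero cases.\<close>

lemma is_C_infinity_ultrametric:
  fixes emb :: "'k::{finite,field} fls alg_closure \<Rightarrow> 'c::{field,complete_space}"
  assumes C: "is_C_infinity emb \<nu>" and q: "1 < real CARD('k)"
  shows "ultrametric_field (\<lambda>x :: 'c. dist x 0)"
proof
  note nrm = is_C_infinity_nrm[OF C]
  have mult: "\<forall>x y. x \<noteq> 0 \<longrightarrow> y \<noteq> 0 \<longrightarrow> \<nu> (x * y) = \<nu> x + \<nu> y"
    using C unfolding is_C_infinity_def by (elim conjE)
  have add: "\<forall>x y. x \<noteq> 0 \<longrightarrow> y \<noteq> 0 \<longrightarrow> x + y \<noteq> 0 \<longrightarrow> min (\<nu> x) (\<nu> y) \<le> \<nu> (x + y)"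
    using C unfolding is_C_infinity_def by (elim conjE)
  fix x y :: 'c
  show "dist x y = dist (x - y) 0"
  proof (cases "x = y")
    case False
    then show ?thesis using C nrm[of "x - y"] unfolding is_C_infinity_def by auto
  qed simp
  show "dist (x * y) 0 = dist x 0 * dist y 0"
  proof (cases "x = 0 \<or> y = 0")
    case False
    then have "\<nu> (x * y) = \<nu> x + \<nu> y" using mult by simp
    then have "dist (x * y) 0 = real CARD('k) powr (- \<nu> x + - \<nu> y)"
      using False nrm[of "x * y"] by simp
    then show ?thesis using False nrm[of x] nrm[of y] by (simp only: powr_add) simp
  qed auto
  show "dist (x + y) 0 \<le> max (dist x 0) (dist y 0)"
  proof (cases "x = 0 \<or> y = 0 \<or> x + y = 0")
    case False
    then have "min (\<nu> x) (\<nu> y) \<le> \<nu> (x + y)" using add by simp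
    then have "\<nu> x \<le> \<nu> (x + y) \<or> \<nu> y \<le> \<nu> (x + y)" by auto
    then have "real CARD('k) powr - \<nu> (x + y) \<le> real CARD('k) powr - \<nu> x \<or>
        real CARD('k) powr - \<nu> (x + y) \<le> real CARD('k) powr - \<nu> y"
      using q by simp
    then show ?thesis using False nrm[of x] nrm[of y] nrm[of "x + y"] by auto
  qed (auto simp: le_max_iff_disj)
qed

locale zeta_setting =
  fixes p :: nat
    and emb :: "'k::{finite,field} fls alg_closure \<Rightarrow> 'c::{field,complete_space}"
    and \<nu> :: "'c \<Rightarrow> real"
    and \<pi> :: "'k fls"
  assumes p: "normalization_semidom_class.prime p"
    and card: "CARD('k) = p"
    and C: "is_C_infinity emb \<nu>"
    and \<pi>: "positive_uniformizer \<pi>"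
begin

definition \<iota> :: "'k fls \<Rightarrow> 'c" where "\<iota> f = emb (to_ac f)"

lemma \<iota>_1 [simp]: "\<iota> 1 = 1"
  using C by (simp add: \<iota>_def is_C_infinity_def)

lemma \<iota>_add: "\<iota> (f + g) = \<iota> f + \<iota> g"
  using C by (simp add: \<iota>_def is_C_infinity_def)

lemma \<iota>_mult: "\<iota> (f * g) = \<iota> f * \<iota> g"
  using C by (simp add: \<iota>_def is_C_infinity_def)

lemma \<iota>_0 [simp]: "\<iota> 0 = 0"
  using \<iota>_add[of 0 0] by (metis add.right_neutral add_left_cancel)

lemma \<iota>_sum: "\<iota> (sum f A) = (\<Sum>i\<in>A. \<iota> (f i))"
  by (induction A rule: infinite_finite_induct) (simp_all add: \<iota>_add)

lemma \<iota>_power: "\<iota> (f ^ n) = \<iota> f ^ n"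
  by (induction n) (simp_all add: \<iota>_mult)

lemma \<iota>_eq_0_iff [simp]: "\<iota> f = 0 \<longleftrightarrow> f = 0"
  using \<iota>_mult[of f "inverse f"] by (cases "f = 0") auto

lemma \<nu>_\<iota>: "f \<noteq> 0 \<Longrightarrow> \<nu> (\<iota> f) = real_of_int (fls_subdegree f)"
  using C by (simp add: \<iota>_def is_C_infinity_def)

lemma p1: "1 < p"
  using p by (rule prime_gt_1_nat)

lemma nrm_eq: "x \<noteq> 0 \<Longrightarrow> dist x 0 = real p powr - \<nu> x"
  using is_C_infinity_nrm[OF C] card by simp

sublocale ultrametric_field "\<lambda>x :: 'c. dist x 0"
  using is_C_infinity_ultrametric[OF C] p1 card by simp

text \<open>The indices of the nonzero coefficients, by \<open>zeta_coeff_valuation\<close>; an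
  initial segment of the natural numbers, possibly all of them.\<close>

definition digit_blocks :: "(nat \<Rightarrow> int) \<Rightarrow> nat set" where
  "digit_blocks y = {i. padic_digit_count_ge p (i * (p - 1)) (padic_uminus p y)}"

definition block_slope :: "(nat \<Rightarrow> int) \<Rightarrow> nat \<Rightarrow> nat" where
  "block_slope y i = padic_low_digits p (i * (p - 1)) (padic_uminus p y)"

lemma zeta_newton_series:
  assumes y: "y \<in> padic_ints p"
  obtains s where "\<forall>i\<in>digit_blocks y. s i = block_slope y i"
    and "newton_series (\<lambda>x. dist x 0) (real p) (\<lambda>i. \<iota> (zeta_coeff \<pi> y i)) (digit_blocks y) s"
    and "newton_points (zeta_coeff \<pi> y) = slope_points (digit_blocks y) s"
proof -
  let ?D = "digit_blocks y"
  have z: "padic_uminus p y \<in> padic_ints p"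
    using padic_uminus_in_padic_ints[OF y] p1 by simp
  have D: "\<forall>i\<in>?D. \<forall>k\<le>i. k \<in> ?D"
    unfolding digit_blocks_def by (auto intro: padic_digit_count_ge_mono mult_le_mono1)
  have "block_slope y i < block_slope y k" if "k \<in> ?D" "i < k" for i k
    unfolding block_slope_def
    by (rule padic_low_digits_strict_mono[OF p z]) (use that p1 in \<open>auto simp: digit_blocks_def\<close>)
  then obtain s where s: "strict_mono s" and sD: "\<And>i. i \<in> ?D \<Longrightarrow> s i = block_slope y i"
    using strict_mono_extend[OF D, of "block_slope y"] by metis
  note val = zeta_coeff_valuation[OF p[folded card] \<pi> y[folded card], unfolded card]
  have nz: "zeta_coeff \<pi> y i \<noteq> 0 \<longleftrightarrow> i \<in> ?D" for i
    unfolding digit_blocks_def using val(1) by simp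
  have sub: "fls_subdegree (zeta_coeff \<pi> y i) = int (\<Sum>t=1..i. s t)" if i: "i \<in> ?D" for i
  proof -
    have "(\<Sum>t=1..i. padic_low_digits p (t * (p - 1)) (padic_uminus p y)) = (\<Sum>t=1..i. s t)"
      by (rule sum.cong) (use i D sD in \<open>auto simp: block_slope_def\<close>)
    then show ?thesis using val(2)[of i] nz i by simp
  qed
  show ?thesis
  proof (rule that)
    show "\<forall>i\<in>?D. s i = block_slope y i" using sD by blast
    show "newton_series (\<lambda>x. dist x 0) (real p) (\<lambda>i. \<iota> (zeta_coeff \<pi> y i)) ?D s"
    proof
      show "1 < real p" "strict_mono s" "0 \<in> ?D" "\<And>i k. i \<in> ?D \<Longrightarrow> k \<le> i \<Longrightarrow> k \<in> ?D"
        using p1 s D by (auto simp: digit_blocks_def)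
      show "dist (\<iota> (zeta_coeff \<pi> y i)) 0
          = (if i \<in> ?D then real p powr - real (\<Sum>t=1..i. s t) else 0)" for i
      proof (cases "i \<in> ?D")
        case True
        then have "zeta_coeff \<pi> y i \<noteq> 0" using nz by simp
        then have "dist (\<iota> (zeta_coeff \<pi> y i)) 0 = real p powr - real_of_int (int (\<Sum>t=1..i. s t))"
          using nrm_eq[of "\<iota> (zeta_coeff \<pi> y i)"] \<nu>_\<iota> sub[OF True] by simp
        then show ?thesis using True by simp
      next
        case False
        then have "zeta_coeff \<pi> y i = 0" using nz by blast
        then show ?thesis using False by simp
      qed
    qed
    show "newton_points (zeta_coeff \<pi> y) = slope_points ?D s"
      unfolding newton_points_def slope_points_def using nz sub by force
  qed
qed

text \<open>The zeta function is a series in \<open>inverse x\<close>. Inversion turns valuation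
  into the exponent of the norm, so the slopes are the valuations of the zeros themselves.\<close>

lemma zeta_zeros_slopes:
  assumes y: "y \<in> padic_ints p"
  shows "\<alpha> \<in> zeta_zeros emb \<pi> y \<Longrightarrow> \<exists>i\<in>digit_blocks y. 1 \<le> i \<and> \<nu> \<alpha> = real (block_slope y i)"
    and "i \<in> digit_blocks y \<Longrightarrow> 1 \<le> i \<Longrightarrow>
      \<exists>!\<beta>. \<beta> \<in> zeta_zeros emb \<pi> y \<and> \<nu> \<beta> = real (block_slope y i)"
proof -
  obtain s where sD: "\<forall>i\<in>digit_blocks y. s i = block_slope y i"
    and ns: "newton_series (\<lambda>x. dist x 0) (real p) (\<lambda>i. \<iota> (zeta_coeff \<pi> y i)) (digit_blocks y) s"
    and "newton_points (zeta_coeff \<pi> y) = slope_points (digit_blocks y) s"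
    using zeta_newton_series[OF y] .
  interpret N: newton_series "\<lambda>x. dist x 0" "real p" "\<lambda>i. \<iota> (zeta_coeff \<pi> y i)" "digit_blocks y" s
    by (rule ns)
  have zero_iff: "\<beta> \<in> zeta_zeros emb \<pi> y \<longleftrightarrow> \<beta> \<noteq> 0 \<and> N.series (inverse \<beta>) = 0" for \<beta>
    unfolding zeta_zeros_def zeta_A_def N.series_def \<iota>_def[symmetric] by simp
  have nrm_inv: "dist (inverse \<beta>) 0 = real p powr \<nu> \<beta>" if "\<beta> \<noteq> 0" for \<beta>
    using nrm_divide[of 1 \<beta>] that by (simp add: nrm_eq[OF that] divide_inverse powr_minus nrm_1)
  show "\<exists>i\<in>digit_blocks y. 1 \<le> i \<and> \<nu> \<alpha> = real (block_slope y i)"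
    if "\<alpha> \<in> zeta_zeros emb \<pi> y"
    using that N.series_zero_slope[OF nrm_inv, of \<alpha>] sD unfolding zero_iff by metis
  assume i: "i \<in> digit_blocks y" "1 \<le> i"
  have eq: "\<beta> \<in> zeta_zeros emb \<pi> y \<and> \<nu> \<beta> = real (block_slope y i) \<longleftrightarrow>
      dist (inverse \<beta>) 0 = real p powr real (s i) \<and> N.series (inverse \<beta>) = 0" for \<beta>
  proof (cases "\<beta> = 0")
    case True
    then show ?thesis using p1 by (simp add: zeta_zeros_def)
  next
    case False
    then show ?thesis using p1 by (auto simp: zero_iff nrm_inv sD[rule_format, OF i(1)] powr_inj)
  qed
  obtain x where x: "dist x 0 = real p powr real (s i)" "N.series x = 0"
    and uniq: "\<And>w. dist w 0 = real p powr real (s i) \<Longrightarrow> N.series w = 0 \<Longrightarrow> w = x"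
    using N.ex1_zero_of_slope[OF i] by blast
  show "\<exists>!\<beta>. \<beta> \<in> zeta_zeros emb \<pi> y \<and> \<nu> \<beta> = real (block_slope y i)"
  proof (rule ex1I[of _ "inverse x"])
    show "inverse x \<in> zeta_zeros emb \<pi> y \<and> \<nu> (inverse x) = real (block_slope y i)"
      unfolding eq using x by simp
    fix \<beta> assume "\<beta> \<in> zeta_zeros emb \<pi> y \<and> \<nu> \<beta> = real (block_slope y i)"
    then have "inverse \<beta> = x" unfolding eq using uniq by blast
    then show "\<beta> = inverse x" by auto
  qed
qed

lemma zeta_coeff_neg_int:
  "zeta_coeff \<pi> (padic_of_int p (- int j)) i = \<pi> ^ (i * j) * power_sum (monics i) j"
proof (rule fls_eqI)
  fix l :: int
  \<comment> \<open>At this stage position \<open>l\<close> is within the precision and the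
    truncation of \<open>j\<close> is \<open>j\<close> itself.\<close>
  define N where "N = max j (nat l)"
  have "N < p ^ N" using power_gt_expt[of p N] p1 by simp
  moreover have "j \<le> N" "nat l \<le> N" by (simp_all add: N_def)
  ultimately have "l < int (p ^ N)" "j < p ^ N" by linarith+
  moreover have "nat (padic_uminus p (padic_of_int p (- int j)) N) = j"
    using \<open>j < p ^ N\<close> by (simp add: padic_uminus_padic_of_int_uminus nat_padic_of_int)
  ultimately show "fls_nth (zeta_coeff \<pi> (padic_of_int p (- int j)) i) l
      = fls_nth (\<pi> ^ (i * j) * power_sum (monics i) j) l"
    using zeta_coeff_nth[OF p[folded card] \<pi>, of "padic_of_int p (- int j)" l N i]
      padic_of_int_in_padic_ints[of p] p1 card by simp
qed

text \<open>At \<open>x = \<pi> ^ j\<close> the powers of \<open>\<pi>\<close> in the coefficients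
  cancel against those of \<open>x\<close>, leaving the finite sum of the power sums of monic
  polynomials.\<close>

lemma trivial_zero:
  assumes "0 < j" "(p - 1) dvd j"
  shows "\<iota> (\<pi> ^ j) \<in> zeta_zeros emb \<pi> (padic_of_int p (- int j))"
proof -
  have \<pi>0: "\<pi> \<noteq> 0" using \<pi> by (simp add: positive_uniformizer_def)
  let ?S = "\<lambda>i. power_sum (monics i :: 'k poly set) j"
  have summand: "\<iota> (zeta_coeff \<pi> (padic_of_int p (- int j)) i) * inverse (\<iota> (\<pi> ^ j)) ^ i = \<iota> (?S i)" for i
  proof -
    have "\<iota> (zeta_coeff \<pi> (padic_of_int p (- int j)) i) = \<iota> (\<pi> ^ j) ^ i * \<iota> (?S i)"
      by (simp add: zeta_coeff_neg_int \<iota>_mult \<iota>_power power_mult[symmetric] mult.commute)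
    then show ?thesis using \<pi>0 by (simp add: power_inverse)
  qed
  \<comment> \<open>A generous cutoff: as \<open>p - 1\<close> is at least 1, any index above the
    digit sum of \<open>j\<close> has too few powers available.\<close>
  have big: "?S i = 0" if "i \<notin> {..<Suc (digit_sum p j)}" for i
  proof (rule power_sum_monics_eq_0[OF p[folded card]])
    have "digit_sum p j < i * 1" using that by simp
    also have "\<dots> \<le> i * (p - 1)" using p1 by (intro mult_le_mono2) simp
    finally show "digit_sum CARD('k) j < i * (CARD('k) - 1)" using card by simp
  qed
  have "zeta_A emb \<pi> (\<iota> (\<pi> ^ j)) (padic_of_int p (- int j)) = (\<Sum>i. \<iota> (?S i))"
    unfolding zeta_A_def \<iota>_def[symmetric] summand ..
  also have "\<dots> = (\<Sum>i<Suc (digit_sum p j). \<iota> (?S i))"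
    by (rule suminf_finite) (use big in auto)
  also have "\<dots> = \<iota> (\<Sum>i<Suc (digit_sum p j). ?S i)" by (simp only: \<iota>_sum)
  also have "(\<Sum>i<Suc (digit_sum p j). ?S i) = 0"
  proof (rule sum_power_sum_monics_eq_0[OF p[folded card]])
    have "Suc (digit_sum p j) * 1 \<le> Suc (digit_sum p j) * (p - 1)" using p1 by (intro mult_le_mono2) simp
    then show "digit_sum CARD('k) j < Suc (digit_sum p j) * (CARD('k) - 1)" using card by simp
  qed (use assms card in auto)
  finally show ?thesis using \<pi>0 by (simp add: zeta_zeros_def)
qed

text \<open>\<open>j\<close> consists of exactly the \<open>i * (p - 1)\<close> smallest powers in
  \<open>-y\<close>. So the polygon at \<open>-j\<close> follows that of \<open>y\<close> for
  \<open>i\<close> segments and then ends.\<close>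

lemma block_slope_neg_int:
  assumes "i \<in> digit_blocks y" and y: "y \<in> padic_ints p" and j: "j = block_slope y i"
  shows "digit_sum p j = i * (p - 1)"
    and "digit_blocks (padic_of_int p (- int j)) = {..i}"
    and "t \<le> i \<Longrightarrow> block_slope (padic_of_int p (- int j)) t = block_slope y t"
proof -
  define z where "z = padic_uminus p y"
  have z: "z \<in> padic_ints p"
    unfolding z_def using padic_uminus_in_padic_ints[OF y] p1 by simp
  obtain N where N: "i * (p - 1) \<le> digit_sum p (nat (z N))"
    using assms(1) by (auto simp: digit_blocks_def padic_digit_count_ge_def z_def)
  have j': "j = low_digits p (i * (p - 1)) (nat (z N))"
    using padic_low_digits_eq[OF p z N] j by (simp add: block_slope_def z_def)
  show dj: "digit_sum p j = i * (p - 1)" unfolding j' by (rule submask_low_digits(2)[OF p N])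
  show "digit_blocks (padic_of_int p (- int j)) = {..i}"
    unfolding digit_blocks_def padic_uminus_padic_of_int_uminus padic_digit_count_ge_of_nat[OF p] dj
    using p1 by auto
  assume t: "t \<le> i"
  then have le: "t * (p - 1) \<le> i * (p - 1)" by (rule mult_le_mono1)
  have "block_slope (padic_of_int p (- int j)) t = low_digits p (t * (p - 1)) j"
    unfolding block_slope_def padic_uminus_padic_of_int_uminus
    using le dj by (intro padic_low_digits_of_nat[OF p]) simp
  also have "\<dots> = low_digits p (t * (p - 1)) (nat (z N))"
    unfolding j' by (rule low_digits_low_digits[OF p le])
  also have "\<dots> = block_slope y t"
    unfolding block_slope_def z_def[symmetric]
    by (rule padic_low_digits_eq[OF p z le_trans[OF le N], symmetric])
  finally show "block_slope (padic_of_int p (- int j)) t = block_slope y t" .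
qed

end

theorem proposition5:
  fixes p :: nat
    and emb :: "'k::{finite,field} fls alg_closure \<Rightarrow> 'c::{field,complete_space}"
    and \<nu> :: "'c \<Rightarrow> real"
    and \<pi> :: "'k fls"
    and y :: "nat \<Rightarrow> int"
    and \<alpha> :: 'c
  assumes "normalization_semidom_class.prime p"
    and "CARD('k) = p"
    and "is_C_infinity emb \<nu>"
    and "positive_uniformizer \<pi>"
    and "y \<in> padic_ints p"
    and "\<alpha> \<in> zeta_zeros emb \<pi> y"
  shows "\<exists>j::nat. \<nu> \<alpha> = real j \<and> j > 0 \<and> (p - 1) dvd j \<and>
    (let n = card {\<beta> \<in> zeta_zeros emb \<pi> y. \<nu> \<beta> \<le> real j};
         minus_j = padic_of_int p (- int j)
     in finite {\<beta> \<in> zeta_zeros emb \<pi> y. \<nu> \<beta> \<le> real j} \<and>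
        real n = real (digit_sum p j) / real (p - 1) \<and>
        newton_equiv \<pi> n minus_j y \<and>
        {\<beta> \<in> zeta_zeros emb \<pi> minus_j. \<nu> \<beta> = real j} = {emb (to_ac (\<pi> ^ j))})"
proof -
  interpret zeta_setting p emb \<nu> \<pi>
    by unfold_locales (fact assms)+
  note y = assms(5)
  let ?Z = "zeta_zeros emb \<pi> y" and ?D = "digit_blocks y"
  obtain s where sD: "\<forall>i\<in>?D. s i = block_slope y i"
    and ns: "newton_series (\<lambda>x. dist x 0) (real p) (\<lambda>i. \<iota> (zeta_coeff \<pi> y i)) ?D s"
    and pts: "newton_points (zeta_coeff \<pi> y) = slope_points ?D s"
    using zeta_newton_series[OF y] .
  interpret N: newton_series "\<lambda>x. dist x 0" "real p" "\<lambda>i. \<iota> (zeta_coeff \<pi> y i)" ?D s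
    by (rule ns)
  obtain i where i: "i \<in> ?D" "1 \<le> i" "\<nu> \<alpha> = real (block_slope y i)"
    using zeta_zeros_slopes(1)[OF y assms(6)] by blast
  define j where "j = block_slope y i"
  note jfacts = block_slope_neg_int[OF i(1) y j_def]
  \<comment> \<open>Positivity of \<open>j\<close> comes from \<open>i \<ge> 1\<close>, since its
    digit sum is \<open>i * (p - 1)\<close>.\<close>
  have "0 < digit_sum p j" using jfacts(1) i(2) p1 by simp
  then have j0: "0 < j" by (cases "j = 0") auto
  have jdvd: "(p - 1) dvd j"
    using dvd_pred_iff_digit_sum[OF p1, of j] jfacts(1) by simp
  define B where "B = {\<beta> \<in> ?Z. \<nu> \<beta> \<le> real j}"
  \<comment> \<open>The zero of valuation \<open>s t\<close>, unique by
    \<open>zeta_zeros_slopes\<close>. As slopes increase strictly, the zeros of valuation at most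
    \<open>j\<close> are those for \<open>t\<close> from 1 to \<open>i\<close>, and their number is
    \<open>i\<close>.\<close>
  define g where "g t = (THE \<beta>. \<beta> \<in> ?Z \<and> \<nu> \<beta> = real (s t))" for t
  have tD: "t \<in> ?D" if "t \<le> i" for t using N.D[OF i(1) that] .
  have ex1: "\<exists>!\<beta>. \<beta> \<in> ?Z \<and> \<nu> \<beta> = real (s t)" if "t \<in> {1..i}" for t
    using zeta_zeros_slopes(2)[OF y tD] sD tD that by simp
  have g: "g t \<in> ?Z" "\<nu> (g t) = real (s t)" if "t \<in> {1..i}" for t
    using theI'[OF ex1[OF that]] unfolding g_def by auto
  have "B = g ` {1..i}"
  proof (intro equalityI subsetI)
    fix \<beta> assume \<beta>: "\<beta> \<in> B"
    then obtain t where t: "t \<in> ?D" "1 \<le> t" "\<nu> \<beta> = real (s t)"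
      using zeta_zeros_slopes(1)[OF y, of \<beta>] sD by (force simp: B_def)
    have "s t \<le> s i" using \<beta> t sD i(1) by (simp add: B_def j_def)
    then have "t \<in> {1..i}" using t(2) strict_mono_less_eq[OF N.s] by simp
    moreover from this have "\<beta> = g t"
      using ex1[of t] g[of t] \<beta> t(3) unfolding B_def by blast
    ultimately show "\<beta> \<in> g ` {1..i}" by blast
  next
    fix \<beta> assume "\<beta> \<in> g ` {1..i}"
    then obtain t where t: "t \<in> {1..i}" "\<beta> = g t" by blast
    then have "s t \<le> s i" using strict_mono_less_eq[OF N.s] by simp
    then show "\<beta> \<in> B" using g[OF t(1)] t(2) sD i(1) by (simp add: B_def j_def)
  qed
  moreover have "inj_on g {1..i}"
    using g(2) strict_mono_eq[OF N.s] by (intro inj_onI) (metis of_nat_eq_iff)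
  ultimately have B: "finite B" "card B = i" by (simp_all add: card_image)
  define y' where "y' = padic_of_int p (- int j)"
  have y': "y' \<in> padic_ints p" using p1 by (simp add: y'_def padic_of_int_in_padic_ints)
  note y'facts = jfacts(2,3)[folded y'_def]
  obtain s' where sD': "\<forall>i\<in>digit_blocks y'. s' i = block_slope y' i"
    and ns': "newton_series (\<lambda>x. dist x 0) (real p) (\<lambda>i. \<iota> (zeta_coeff \<pi> y' i)) (digit_blocks y') s'"
    and pts': "newton_points (zeta_coeff \<pi> y') = slope_points (digit_blocks y') s'"
    using zeta_newton_series[OF y'] .
  interpret N': newton_series "\<lambda>x. dist x 0" "real p" "\<lambda>i. \<iota> (zeta_coeff \<pi> y' i)" "digit_blocks y'" s'
    by (rule ns')
  have DD: "\<forall>i\<in>?D. \<forall>k\<le>i. k \<in> ?D" "\<forall>i\<in>digit_blocks y'. \<forall>k\<le>i. k \<in> digit_blocks y'"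
    using N.D N'.D by blast+
  have i': "i \<in> digit_blocks y'" by (simp add: y'facts)
  have "s' t = s t" if "t \<le> i" for t
    using that sD sD' tD[OF that] y'facts by simp
  then have "same_first_segments (slope_points (digit_blocks y') s') (slope_points ?D s) i"
    by (intro slope_points_same_first_segments[OF N'.s N.s DD(2,1) i' i(1)])
  then have "has_finite_slopes (slope_points (digit_blocks y') s') i \<and>
      has_finite_slopes (slope_points ?D s) i \<and>
      same_first_segments (slope_points (digit_blocks y') s') (slope_points ?D s) i"
    using has_finite_slopes_slope_points[OF N'.s DD(2) i']
      has_finite_slopes_slope_points[OF N.s DD(1) i(1)] by blast
  then have equiv: "newton_equiv \<pi> i y' y"
    by (simp add: newton_equiv_def pts pts')
  \<comment> \<open>\<open>j\<close> is also the \<open>i\<close>-th slope at \<open>-j\<close>, so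
    the zero of this valuation is unique and must be the trivial one.\<close>
  have "\<exists>!\<beta>. \<beta> \<in> zeta_zeros emb \<pi> y' \<and> \<nu> \<beta> = real j"
    using zeta_zeros_slopes(2)[OF y', of i] y'facts i(2) by (simp add: j_def)
  moreover have "\<iota> (\<pi> ^ j) \<in> zeta_zeros emb \<pi> y'"
    unfolding y'_def by (rule trivial_zero[OF j0 jdvd])
  moreover have "\<nu> (\<iota> (\<pi> ^ j)) = real j"
    using \<pi> by (simp add: \<nu>_\<iota> positive_uniformizer_def fls_subdegree_pow)
  ultimately have "{\<beta> \<in> zeta_zeros emb \<pi> y'. \<nu> \<beta> = real j} = {\<iota> (\<pi> ^ j)}" by blast
  then show ?thesis
    using i(3) j0 jdvd B equiv jfacts(1) p1
    unfolding y'_def B_def j_def[symmetric] \<iota>_def Let_def by (intro exI[of _ j]) simp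
qed

end
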